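(* For an ordinal $\alpha$ and a nonzero natural number $k$, let $G_{\alpha,k}=\mathrm{Homeo}([0,\omega^\alpha\cdot k])$. If $G_{\alpha,k}$ and $G_{\alpha',k'}$ are isomorphic as topological groups, then $\alpha=\alpha'$ and $k=k'$. In particular, if two compact ordinal spaces have homeomorphism groups isomorphic as topological groups, then the two spaces are homeomorphic.
   Context: An ordinal space is an ordinal with its order topology; $[0,\gamma]=\gamma+1$ denotes the ordinal space of ordinals $\le\gamma$. The compact ordinal spaces are $0$ and the successor ordinals. Homeomorphism groups of ordinal spaces carry the topology of pointwise convergence.
   Formalization: The "in particular" claim is stated for nonempty compact ordinal spaces (successor ordinals) only: the empty space 0 is excluded, since 0 and the one-point space 1 both have trivial homeomorphism group but are not homeomorphic. *)

theory Defs
  imports "HOL-Analysis.Analysis"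
begin

text \<open>Ordinals are represented by well-order relations (library notion Well_order,
isomorphism of ordinals = ordIso). For a well-order r of order type gamma, the ordinal
space [0,gamma] = gamma+1 is the set Some ` Field r with an extra top point None,
carrying the order topology.\<close>

definition ord_lt :: "'a rel \<Rightarrow> 'a option \<Rightarrow> 'a option \<Rightarrow> bool" where
  "ord_lt r x y = (case (x, y) of
      (Some a, Some b) \<Rightarrow> (a, b) \<in> r \<and> a \<noteq> b
    | (Some a, None) \<Rightarrow> True
    | _ \<Rightarrow> False)"

definition ord_carrier :: "'a rel \<Rightarrow> 'a option set" where
  "ord_carrier r = Some ` Field r \<union> {None}"

definition ord_space :: "'a rel \<Rightarrow> 'a option topology" where
  "ord_space r = topology_generated_by
     ({ord_carrier r}
      \<union> {{x \<in> ord_carrier r. ord_lt r x a} | a. a \<in> ord_carrier r}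
      \<union> {{x \<in> ord_carrier r. ord_lt r a x} | a. a \<in> ord_carrier r})"

text \<open>The ordinal omega^alpha * k, as a well-order: pairs (i, f) with i < k and
f a finitely supported function from Field alpha to nat (standard model of omega^alpha,
ordered by comparing at the largest point of difference); the copy index i is most
significant, giving k consecutive copies of omega^alpha, i.e. omega^alpha * k.\<close>
definition oexp_carrier :: "'a rel \<Rightarrow> nat \<Rightarrow> (nat \<times> ('a \<Rightarrow> nat)) set" where
  "oexp_carrier r k = {(i, f). i < k \<and> (\<forall>x. x \<notin> Field r \<longrightarrow> f x = 0) \<and> finite {x. f x \<noteq> 0}}"

definition omega_pow_mult :: "'a rel \<Rightarrow> nat \<Rightarrow> (nat \<times> ('a \<Rightarrow> nat)) rel" where
  "omega_pow_mult r k = {((i, f), (j, g)).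
      (i, f) \<in> oexp_carrier r k \<and> (j, g) \<in> oexp_carrier r k \<and>
      (i < j \<or> (i = j \<and> (f = g \<or>
         (\<exists>x\<in>Field r. f x < g x \<and> (\<forall>y\<in>Field r. (x, y) \<in> r \<and> y \<noteq> x \<longrightarrow> f y = g y)))))}"

definition homeo_group :: "'a topology \<Rightarrow> ('a \<Rightarrow> 'a) set" where
  "homeo_group X = {h \<in> topspace X \<rightarrow>\<^sub>E topspace X. homeomorphic_map X X h}"

definition homeo_top :: "'a topology \<Rightarrow> ('a \<Rightarrow> 'a) topology" where
  "homeo_top X = subtopology (product_topology (\<lambda>_. X) (topspace X)) (homeo_group X)"

definition topgrp_iso :: "'a topology \<Rightarrow> 'b topology \<Rightarrow> (('a \<Rightarrow> 'a) \<Rightarrow> ('b \<Rightarrow> 'b)) \<Rightarrow> bool" where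
  "topgrp_iso X Y \<phi> \<longleftrightarrow>
     bij_betw \<phi> (homeo_group X) (homeo_group Y) \<and>
     (\<forall>g\<in>homeo_group X. \<forall>h\<in>homeo_group X.
        \<phi> (compose (topspace X) g h) = compose (topspace Y) (\<phi> g) (\<phi> h)) \<and>
     homeomorphic_map (homeo_top X) (homeo_top Y) \<phi>"

end

theory Submission
  imports Defs "HOL-Combinatorics.Permutations" "HOL-Library.Multiset"
begin

text \<open>Already the abstract group determines the space. The group acts faithfully on the dense
  set D of isolated points and contains all finitary permutations of D. If D is infinite, the
  transpositions are the involutions that commute or satisfy the braid relation with each of
  their conjugates, and so a group isomorphism is induced by a bijection b between the sets of
  isolated points. Two subsets of D whose closures meet outside D contain infinite sets S and T
  such that all points of S and T converge to one point, and then every permutation of the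
  union of S and T, extended by the identity, is a homeomorphism. Conversely, mixing two
  sequences with different limits by a permutation yields no homeomorphism. Hence b and its
  inverse preserve the relation of having disjoint closures, and both extend continuously by
  compactness. Finally the exponent and the multiplicity are recovered from the space as its
  Cantor--Bendixson rank and the number of points of maximal rank.\<close>

section \<open>Groups of permutations containing the finitary ones\<close>

text \<open>The group sees limit points only through the question which permutations of D extend
  continuously; this is why convergence is formulated for whole sets of isolated points. A point x
  of uncountable cofinality is not the limit of any sequence of smaller points, so two sets with the
  common limit x need not contain sequences tending to x. An increasing sequence that alternates
  between the two sets has a supremum y at or below x, and y serves instead. This is also why b is
  extended by means of disjointness of closures, a relation that names no limit point. A finite D
  must be treated apart: the symmetric group on six points has an automorphism that does not
  preserve transpositions, so only the number n of points is recovered, from n!. That needs n > 0,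
  since the empty space and the one-point space both have a trivial group. Finally, for \<alpha> = 0
  all k + 1 points have maximal rank, while otherwise k points do, so the exponent has to be known
  before k can be read off.\<close>

abbreviation tr :: "'a \<Rightarrow> 'a \<Rightarrow> 'a \<Rightarrow> 'a" where
  "tr \<equiv> Transposition.transpose"

lemmas tr_def = Transposition.transpose_def

text \<open>Elements of P are the identity outside D, so composition and \<open>id\<close> on the
  whole type are the group operations.\<close>

locale finitary_perms =
  fixes D :: "'a set" and P :: "('a \<Rightarrow> 'a) set"
  assumes infinite_dom: "infinite D"
    and permutes_dom: "p \<in> P \<Longrightarrow> p permutes D"
    and comp_closed: "p \<in> P \<Longrightarrow> q \<in> P \<Longrightarrow> p \<circ> q \<in> P"
    and transpose_mem: "a \<in> D \<Longrightarrow> b \<in> D \<Longrightarrow> tr a b \<in> P"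
begin

definition transpositions :: "('a \<Rightarrow> 'a) set" where
  "transpositions = {tr a b | a b. a \<in> D \<and> b \<in> D \<and> a \<noteq> b}"

text \<open>The conjugate of t by g enters as a t' with \<open>g \<circ> t = t' \<circ> g\<close>,
  so that inverses are never mentioned: the condition uses only composition and \<open>id\<close>,
  and an isomorphism carries it over.\<close>

definition three_transp :: "('a \<Rightarrow> 'a) \<Rightarrow> bool" where
  "three_transp t \<longleftrightarrow> t \<in> P \<and> t \<noteq> id \<and> t \<circ> t = id \<and>
     (\<forall>g\<in>P. \<forall>t'\<in>P. g \<circ> t = t' \<circ> g \<longrightarrow> t \<circ> t' = t' \<circ> t \<or> t \<circ> t' \<circ> t = t' \<circ> t \<circ> t')"

lemma id_mem: "id \<in> P"
proof -
  obtain a where "a \<in> D" using infinite_dom by (metis finite.emptyI ex_in_conv)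
  then show ?thesis using transpose_mem[of a a] by simp
qed

lemma ex_avoiding:
  assumes "finite F"
  obtains z where "z \<in> D" "z \<notin> F"
  using infinite_dom assms by (meson finite_subset subsetI)

lemma conj_transpose:
  assumes "g \<in> P"
  shows "g \<circ> tr a b = tr (g a) (g b) \<circ> g"
proof -
  have "inj g" using permutes_dom[OF assms] by (rule permutes_inj)
  then show ?thesis by (auto simp: fun_eq_iff tr_def inj_eq)
qed

text \<open>Conjugates of (a b) are transpositions again, and two transpositions commute if they are
  equal or disjoint and satisfy the braid relation if they share exactly one point.\<close>

lemma transposition_three_transp:
  assumes "t \<in> transpositions"
  shows "three_transp t"
proof -
  obtain a b where t: "t = tr a b" "a \<in> D" "b \<in> D" "a \<noteq> b"
    using assms by (auto simp: transpositions_def)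
  have "t \<circ> t' = t' \<circ> t \<or> t \<circ> t' \<circ> t = t' \<circ> t \<circ> t'"
    if g: "g \<in> P" and t': "g \<circ> t = t' \<circ> g" for g t'
  proof -
    have "surj g" using permutes_dom[OF g] by (rule permutes_surj)
    moreover have "t' \<circ> g = tr (g a) (g b) \<circ> g"
      using conj_transpose[OF g] t' t by simp
    ultimately have "t' = tr (g a) (g b)"
      by (metis surj_fun_eq comp_apply)
    moreover have "g a \<noteq> g b"
      using permutes_inj[OF permutes_dom[OF g]] t(4) by (simp add: inj_eq)
    moreover have "tr a b \<circ> tr c d = tr c d \<circ> tr a b
        \<or> tr a b \<circ> tr c d \<circ> tr a b
          = tr c d \<circ> tr a b \<circ> tr c d"
      if "c \<noteq> d" for c d
      using that t(4) by (cases "a = c"; cases "a = d"; cases "b = c"; cases "b = d")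
        (simp_all add: fun_eq_iff tr_def)
    ultimately show ?thesis using t by blast
  qed
  moreover have "t \<noteq> id" using t by (metis id_apply transpose_apply_first)
  ultimately show ?thesis
    using t transpose_mem by (auto simp: three_transp_def)
qed

text \<open>If an involution moves four distinct points a, b, c, d as (a b)(c d), conjugating it
  by (b c)(d e), extended so that it moves the image f of e, gives an involution with which
  it neither commutes nor satisfies the braid relation; both failures are seen at a.\<close>

lemma three_transp_transposition:
  assumes "three_transp t"
  shows "t \<in> transpositions"
proof (rule ccontr)
  assume nt: "t \<notin> transpositions"
  have tP: "t \<in> P" and t1: "t \<noteq> id" and tt: "\<And>x. t (t x) = x"
    and rel: "\<And>g t'. \<lbrakk>g \<in> P; t' \<in> P; g \<circ> t = t' \<circ> g\<rbrakk>
        \<Longrightarrow> t \<circ> t' = t' \<circ> t \<or> t \<circ> t' \<circ> t = t' \<circ> t \<circ> t'"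
    using assms by (auto simp: three_transp_def fun_eq_iff)
  note pt = permutes_dom[OF tP]
  obtain a where a: "t a \<noteq> a" using t1 by (auto simp: fun_eq_iff)
  define b where "b = t a"
  have aD: "a \<in> D" using a pt by (metis permutes_not_in)
  have bD: "b \<in> D" using aD pt by (simp add: b_def permutes_in_image)
  have "t \<noteq> tr a b"
    using nt aD bD a unfolding transpositions_def b_def by (metis (mono_tags, lifting) mem_Collect_eq)
  then obtain c where c: "t c \<noteq> tr a b c" by (auto simp: fun_eq_iff)
  then have cab: "c \<noteq> a" "c \<noteq> b" using tt by (auto simp: b_def)
  then have "t c \<noteq> c" using c by simp
  define d where "d = t c"
  have cD: "c \<in> D" using \<open>t c \<noteq> c\<close> pt by (metis permutes_not_in)
  have dD: "d \<in> D" using cD pt by (simp add: d_def permutes_in_image)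
  have tb: "t b = a" and td: "t d = c" by (simp_all add: b_def d_def tt)
  have dist: "a \<noteq> b" "a \<noteq> c" "a \<noteq> d" "b \<noteq> c" "b \<noteq> d" "c \<noteq> d"
    using a cab \<open>t c \<noteq> c\<close> tb td b_def d_def tt by metis+
  obtain e where e: "e \<in> D" "e \<notin> {a, b, c, d}" using ex_avoiding[of "{a,b,c,d}"] by auto
  define f where "f = t e"
  have fD: "f \<in> D" using e pt by (simp add: f_def permutes_in_image)
  have f: "f \<notin> {a, b, c, d}"
    using e tt tb td b_def d_def f_def by (metis insertE insertI1 insertI2 singletonD)
  obtain z where z: "z \<in> D" "z \<notin> {a, b, c, d, e, f}"
    using ex_avoiding[of "{a,b,c,d,e,f}"] by auto
  \<comment> \<open>If t fixes e, then f = e is already moved by (d e), and \<open>tr f z'\<close>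
    collapses to the identity; otherwise the last factor of g sends f to the fresh point z.\<close>
  define z' where "z' = (if f = e then f else z)"
  have z'D: "z' \<in> D" using z fD by (auto simp: z'_def)
  define g where "g = tr b c \<circ> (tr d e \<circ> tr f z')"
  have gP: "g \<in> P" unfolding g_def using z'D by (intro comp_closed transpose_mem bD cD dD e(1) fD)
  have tr_simps: "tr b c a = a" "tr b c d = d" "tr b c e = e" "tr d e a = a" "tr d e b = b"
    "tr d e c = c" "tr f z' a = a" "tr f z' b = b" "tr f z' c = c" "tr f z' d = d" "tr f z' e = e"
    using dist e f z by (auto simp: tr_def z'_def)
  \<comment> \<open>The inverse of g, written as a product of transpositions so that membership in P
    follows from the locale assumptions.\<close>
  define g' where "g' = tr f z' \<circ> (tr d e \<circ> tr b c)"
  have g'P: "g' \<in> P" unfolding g'_def using z'D by (intro comp_closed transpose_mem bD cD dD e(1) fD)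
  have g'g: "g' (g x) = x" for x
    by (simp add: g_def g'_def)
  have g': "g' a = a" "g' b = c" "g' d = e"
    using tr_simps by (simp_all add: g'_def)
  have g: "g a = a" "g b = c" "g c = b" "g d = e" "g e = d"
    using tr_simps by (simp_all add: g_def)
  have gf: "g f \<noteq> f"
  proof (cases "f = e")
    case True then show ?thesis using g e by auto
  next
    case False
    then have "g f = z" using e f z by (simp add: g_def z'_def)
    then show ?thesis using z by auto
  qed
  define t' where "t' = g \<circ> (t \<circ> g')"
  have "t' \<in> P" unfolding t'_def by (intro comp_closed gP g'P tP)
  moreover have "g \<circ> t = t' \<circ> g"
    using g'g by (simp add: t'_def fun_eq_iff)
  ultimately have "t \<circ> t' = t' \<circ> t \<or> t \<circ> t' \<circ> t = t' \<circ> t \<circ> t'"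
    using rel gP by blast
  moreover have "(t \<circ> t') a = d" "(t' \<circ> t) a = e" "(t \<circ> t' \<circ> t) a = f" "(t' \<circ> t \<circ> t') a = g f"
    using g g' tb td by (simp_all add: t'_def b_def[symmetric] d_def[symmetric] f_def[symmetric])
  ultimately show False using g gf e f by (metis insertCI)
qed

lemma transpositions_iff: "t \<in> transpositions \<longleftrightarrow> three_transp t"
  using transposition_three_transp three_transp_transposition by blast

end

section \<open>Isomorphisms of such groups and the bijection of points they induce\<close>

locale finitary_perms_iso = A: finitary_perms D P + B: finitary_perms D' P'
  for D :: "'a set" and P :: "('a \<Rightarrow> 'a) set" and D' :: "'b set" and P' :: "('b \<Rightarrow> 'b) set" +
  fixes \<psi> :: "('a \<Rightarrow> 'a) \<Rightarrow> ('b \<Rightarrow> 'b)"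
  assumes bij: "bij_betw \<psi> P P'"
    and hom: "p \<in> P \<Longrightarrow> q \<in> P \<Longrightarrow> \<psi> (p \<circ> q) = \<psi> p \<circ> \<psi> q"
begin

lemma \<psi>_mem: "p \<in> P \<Longrightarrow> \<psi> p \<in> P'"
  using bij by (auto simp: bij_betw_def)

lemma \<psi>_inj: "p \<in> P \<Longrightarrow> q \<in> P \<Longrightarrow> \<psi> p = \<psi> q \<longleftrightarrow> p = q"
  using bij by (auto simp: bij_betw_def inj_on_def)

lemma \<psi>_id: "\<psi> id = id"
proof -
  have "inj (\<psi> id)" using permutes_inj B.permutes_dom \<psi>_mem A.id_mem by blast
  moreover have "\<psi> id \<circ> \<psi> id = \<psi> id" using hom[OF A.id_mem A.id_mem] by simp
  ultimately show ?thesis by (auto simp: fun_eq_iff inj_eq)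
qed

lemma inverse_iso: "finitary_perms_iso D' P' D P (inv_into P \<psi>)"
proof
  show "bij_betw (inv_into P \<psi>) P' P" using bij by (rule bij_betw_inv_into)
next
  fix p q assume pq: "p \<in> P'" "q \<in> P'"
  let ?i = "inv_into P \<psi>"
  have i: "?i p \<in> P" "?i q \<in> P" "\<psi> (?i p) = p" "\<psi> (?i q) = q"
    using pq bij by (auto simp: bij_betw_def inv_into_into f_inv_into_f)
  then have "\<psi> (?i p \<circ> ?i q) = p \<circ> q" by (simp add: hom)
  then show "?i (p \<circ> q) = ?i p \<circ> ?i q"
    using i A.comp_closed bij by (metis bij_betw_inv_into_left)
qed

lemma three_transp_imp:
  assumes "A.three_transp t"
  shows "B.three_transp (\<psi> t)"
proof -
  have t: "t \<in> P" "t \<noteq> id" "t \<circ> t = id"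
    and rel: "\<And>g t'. \<lbrakk>g \<in> P; t' \<in> P; g \<circ> t = t' \<circ> g\<rbrakk>
        \<Longrightarrow> t \<circ> t' = t' \<circ> t \<or> t \<circ> t' \<circ> t = t' \<circ> t \<circ> t'"
    using assms by (auto simp: A.three_transp_def)
  have "\<psi> t \<circ> s' = s' \<circ> \<psi> t \<or> \<psi> t \<circ> s' \<circ> \<psi> t = s' \<circ> \<psi> t \<circ> s'"
    if "h \<in> P'" "s' \<in> P'" and eq: "h \<circ> \<psi> t = s' \<circ> h" for h s'
  proof -
    obtain g t' where g: "g \<in> P" "h = \<psi> g" and t': "t' \<in> P" "s' = \<psi> t'"
      using \<open>h \<in> P'\<close> \<open>s' \<in> P'\<close> bij by (auto simp: bij_betw_def)
    have "\<psi> (g \<circ> t) = \<psi> (t' \<circ> g)" using eq g t' t by (simp add: hom)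
    then have "g \<circ> t = t' \<circ> g" using g t' t A.comp_closed \<psi>_inj by blast
    then have "t \<circ> t' = t' \<circ> t \<or> t \<circ> t' \<circ> t = t' \<circ> t \<circ> t'" using rel g t' by blast
    then show ?thesis
      using hom t t' A.comp_closed by metis
  qed
  moreover have "\<psi> t \<circ> \<psi> t = id" using hom[of t t] t \<psi>_id by simp
  moreover have "\<psi> t \<noteq> id" using \<psi>_inj[of t id] \<psi>_id A.id_mem t by simp
  ultimately show ?thesis using t \<psi>_mem by (auto simp: B.three_transp_def)
qed

lemma \<psi>_transpose:
  assumes "a \<in> D" "b \<in> D" "a \<noteq> b"
  obtains x y where "x \<in> D'" "y \<in> D'" "x \<noteq> y" "\<psi> (tr a b) = tr x y"
proof -
  have "tr a b \<in> A.transpositions" using assms by (auto simp: A.transpositions_def)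
  then have "\<psi> (tr a b) \<in> B.transpositions"
    using three_transp_imp A.transpositions_iff B.transpositions_iff by blast
  then show ?thesis using that by (auto simp: B.transpositions_def)
qed

text \<open>The transpositions that are images of some (a p) all move one common point, which will be
  the image of a. Otherwise the images of some (a p), (a q), (a r) would form a triangle; but
  the third side of the triangle on the first two is the image of (p q), a conjugate of (a q)
  by (a p).\<close>

lemma triangle:
  assumes "a \<in> D" "p \<in> D" "q \<in> D" "a \<noteq> p" "a \<noteq> q" "p \<noteq> q"
    and "\<psi> (tr a p) = tr x y" "\<psi> (tr a q) = tr x z"
    and "x \<noteq> y" "x \<noteq> z" "y \<noteq> z"
  shows "\<psi> (tr p q) = tr y z"
proof -
  have "tr p q = tr a p \<circ> (tr a q \<circ> tr a p)"
    using assms by (auto simp: fun_eq_iff tr_def)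
  then have "\<psi> (tr p q) = tr x y \<circ> (tr x z \<circ> tr x y)"
    using assms by (simp add: hom A.comp_closed A.transpose_mem)
  also have "\<dots> = tr y z"
    using assms by (auto simp: fun_eq_iff tr_def)
  finally show ?thesis .
qed

text \<open>(a p) and (a q) do not commute, so neither do their images; two transpositions that fail
  to commute overlap in exactly one point.\<close>

lemma shared_point:
  assumes "a \<in> D" "p \<in> D" "q \<in> D" "a \<noteq> p" "a \<noteq> q" "p \<noteq> q"
  obtains x y z where "x \<in> D'" "y \<in> D'" "z \<in> D'" "x \<noteq> y" "x \<noteq> z" "y \<noteq> z"
    "\<psi> (tr a p) = tr x y" "\<psi> (tr a q) = tr x z"
proof -
  obtain x y where xy: "x \<in> D'" "y \<in> D'" "x \<noteq> y" "\<psi> (tr a p) = tr x y"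
    using \<psi>_transpose[of a p] assms by metis
  obtain u v where uv: "u \<in> D'" "v \<in> D'" "u \<noteq> v" "\<psi> (tr a q) = tr u v"
    using \<psi>_transpose[of a q] assms by metis
  have mem: "tr a p \<in> P" "tr a q \<in> P" using assms A.transpose_mem by auto
  have "(tr a p \<circ> tr a q) p \<noteq> (tr a q \<circ> tr a p) p"
    using assms by (auto simp: tr_def)
  then have "tr a p \<circ> tr a q \<noteq> tr a q \<circ> tr a p" by metis
  then have nc: "tr x y \<circ> tr u v \<noteq> tr u v \<circ> tr x y"
    using mem xy uv hom \<psi>_inj A.comp_closed by metis
  then have "{x, y} \<noteq> {u, v}" by (auto simp: doubleton_eq_iff transpose_commute)
  moreover have "{x, y} \<inter> {u, v} \<noteq> {}"
  proof
    assume "{x, y} \<inter> {u, v} = {}"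
    then have "tr x y \<circ> tr u v = tr u v \<circ> tr x y"
      by (auto simp: fun_eq_iff tr_def)
    then show False using nc by simp
  qed
  ultimately consider "x = u" "y \<noteq> v" | "x = v" "y \<noteq> u" | "y = u" "x \<noteq> v" | "y = v" "x \<noteq> u"
    by blast
  then show ?thesis
    by cases (use xy uv that transpose_commute in metis)+
qed

lemma star_point:
  assumes "a \<in> D"
  obtains x where "x \<in> D'" "\<And>p. p \<in> D \<Longrightarrow> p \<noteq> a \<Longrightarrow> \<psi> (tr a p) x \<noteq> x"
proof -
  obtain p where p: "p \<in> D" "p \<noteq> a" using A.ex_avoiding[of "{a}"] by auto
  obtain q where q: "q \<in> D" "q \<noteq> a" "q \<noteq> p" using A.ex_avoiding[of "{a, p}"] by auto
  obtain x y z where *: "x \<in> D'" "y \<in> D'" "z \<in> D'" "x \<noteq> y" "x \<noteq> z" "y \<noteq> z"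
    "\<psi> (tr a p) = tr x y" "\<psi> (tr a q) = tr x z"
    using shared_point[of a p q] assms p q by metis
  have tri: "\<psi> (tr p q) = tr y z"
    using triangle[of a p q x y z] * assms p q by auto
  have "\<psi> (tr a r) x \<noteq> x" if r: "r \<in> D" "r \<noteq> a" for r
  proof (cases "r = p \<or> r = q")
    case True then show ?thesis using * by auto
  next
    case False
    obtain x1 y1 z1 where 1: "x1 \<noteq> y1" "x1 \<noteq> z1" "y1 \<noteq> z1"
      "\<psi> (tr a p) = tr x1 y1" "\<psi> (tr a r) = tr x1 z1"
      using shared_point[of a p r] assms p r False by metis
    obtain x2 y2 z2 where 2: "x2 \<noteq> y2" "x2 \<noteq> z2" "y2 \<noteq> z2"
      "\<psi> (tr a q) = tr x2 y2" "\<psi> (tr a r) = tr x2 z2"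
      using shared_point[of a q r] assms q r False by metis
    have "tr a r \<noteq> tr p q"
      using p q by (metis transpose_apply_first transpose_apply_other r(2))
    then have ne: "\<psi> (tr a r) \<noteq> tr y z"
      using \<psi>_inj tri assms p q r A.transpose_mem by metis
    have supp: "(tr u v w \<noteq> w) = (w = u \<or> w = v)" if "u \<noteq> v" for u v w :: 'b
      using that by (auto simp: tr_def)
    \<comment> \<open>The support {x1, z1} of the image of (a r) contains x1 from {x, y} and meets
      {x, z} in x2; if it missed x, it would be {y, z}, the excluded third side.\<close>
    have "{x1, y1} = {x, y}" "{x2, y2} = {x, z}" "{x1, z1} = {x2, z2}"
      using supp 1 2 * by (intro set_eqI; metis insert_iff singletonD)+
    moreover have "{x1, z1} \<noteq> {y, z}"
      using ne 1 by (auto simp: doubleton_eq_iff transpose_commute)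
    ultimately have "x \<in> {x1, z1}" using 1 2 * by (auto simp: doubleton_eq_iff)
    then show ?thesis using supp 1 by auto
  qed
  then show ?thesis using that * by blast
qed

definition pt :: "'a \<Rightarrow> 'b" where
  "pt a = (SOME x. x \<in> D' \<and> (\<forall>p\<in>D. p \<noteq> a \<longrightarrow> \<psi> (tr a p) x \<noteq> x))"

lemma pt:
  assumes "a \<in> D"
  shows "pt a \<in> D'" "\<And>p. p \<in> D \<Longrightarrow> p \<noteq> a \<Longrightarrow> \<psi> (tr a p) (pt a) \<noteq> pt a"
proof -
  have "\<exists>x. x \<in> D' \<and> (\<forall>p\<in>D. p \<noteq> a \<longrightarrow> \<psi> (tr a p) x \<noteq> x)"
    using star_point[OF assms] by metis
  then have "pt a \<in> D' \<and> (\<forall>p\<in>D. p \<noteq> a \<longrightarrow> \<psi> (tr a p) (pt a) \<noteq> pt a)"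
    unfolding pt_def by (rule someI_ex)
  then show "pt a \<in> D'" "\<And>p. p \<in> D \<Longrightarrow> p \<noteq> a \<Longrightarrow> \<psi> (tr a p) (pt a) \<noteq> pt a" by auto
qed

text \<open>A common value would be moved by the images of (a p), (a q) and (p q), but these are the
  sides of a triangle and have no point in common.\<close>

lemma point_inj:
  assumes "a \<in> D" "p \<in> D" "a \<noteq> p"
  shows "pt a \<noteq> pt p"
proof
  assume eq: "pt a = pt p"
  obtain q where q: "q \<in> D" "q \<noteq> a" "q \<noteq> p" using A.ex_avoiding[of "{a, p}"] by auto
  obtain x y z where *: "x \<noteq> y" "x \<noteq> z" "y \<noteq> z"
    "\<psi> (tr a p) = tr x y" "\<psi> (tr a q) = tr x z"
    using shared_point[of a p q] assms q by metis
  have "\<psi> (tr p q) = tr y z"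
    using triangle[of a p q x y z] * assms q by auto
  moreover have "\<psi> (tr p q) (pt a) \<noteq> pt a" using pt(2)[of p q] assms q eq by simp
  moreover have "\<psi> (tr a p) (pt a) \<noteq> pt a" "\<psi> (tr a q) (pt a) \<noteq> pt a"
    using pt(2) assms q by auto
  ultimately show False using * by (auto simp: tr_def split: if_splits)
qed

lemma \<psi>_transpose_pt:
  assumes "a \<in> D" "p \<in> D" "a \<noteq> p"
  shows "\<psi> (tr a p) = tr (pt a) (pt p)"
proof -
  obtain x y where xy: "x \<noteq> y" "\<psi> (tr a p) = tr x y"
    using \<psi>_transpose assms by metis
  have "tr x y (pt a) \<noteq> pt a" "tr x y (pt p) \<noteq> pt p"
    using pt(2)[of a p] pt(2)[of p a] assms xy by (auto simp: transpose_commute)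
  then have "{pt a, pt p} = {x, y}"
    using point_inj[OF assms] by (auto simp: tr_def split: if_splits)
  then show ?thesis using xy by (auto simp: doubleton_eq_iff transpose_commute)
qed

lemma pt_unique:
  assumes "a \<in> D" and x: "\<And>p. p \<in> D \<Longrightarrow> p \<noteq> a \<Longrightarrow> \<psi> (tr a p) x \<noteq> x"
  shows "x = pt a"
proof -
  obtain p where p: "p \<in> D" "p \<noteq> a" using A.ex_avoiding[of "{a}"] by auto
  obtain q where q: "q \<in> D" "q \<noteq> a" "q \<noteq> p" using A.ex_avoiding[of "{a, p}"] by auto
  have "pt p \<noteq> pt q" using p q point_inj by metis
  moreover have "x = pt a \<or> x = pt p" "x = pt a \<or> x = pt q"
    using x[OF p] x[OF q(1,2)] \<psi>_transpose_pt[of a p] \<psi>_transpose_pt[of a q] p q assms(1)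
    by (auto simp: tr_def split: if_splits)
  ultimately show ?thesis by blast
qed

text \<open>Conjugation by g takes (a p) to (g a, g p), so \<open>\<psi> g\<close> takes the point
  moved by the images of all (a p) to one moved by the images of all (g a, p'); uniqueness
  identifies the latter as \<open>pt (g a)\<close>.\<close>

lemma \<psi>_apply_pt:
  assumes "g \<in> P" "a \<in> D"
  shows "\<psi> g (pt a) = pt (g a)"
proof (rule pt_unique)
  note pg = A.permutes_dom[OF assms(1)]
  show ga: "g a \<in> D" using pg assms by (simp add: permutes_in_image)
  fix p' assume p': "p' \<in> D" "p' \<noteq> g a"
  then obtain p where p: "p \<in> D" "p' = g p" using pg by (metis imageE permutes_image)
  then have ap: "p \<noteq> a" using p' by blast
  have "\<psi> g \<circ> \<psi> (tr a p) = \<psi> (tr (g a) p') \<circ> \<psi> g"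
    using A.conj_transpose[OF assms(1), of a p] hom assms p p' ga A.transpose_mem by metis
  then have "\<psi> (tr (g a) p') (\<psi> g (pt a)) = \<psi> g (\<psi> (tr a p) (pt a))"
    by (metis comp_apply)
  moreover have "inj (\<psi> g)" using B.permutes_dom[OF \<psi>_mem[OF assms(1)]] by (rule permutes_inj)
  ultimately show "\<psi> (tr (g a) p') (\<psi> g (pt a)) \<noteq> \<psi> g (pt a)"
    using pt(2)[OF assms(2) p(1) ap] by (simp add: inj_eq)
qed

text \<open>Composing the point maps of \<open>\<psi>\<close> and of its inverse takes every
  transposition (x q) to itself, so the composite fixes x, and x is attained.\<close>

lemma pt_surj:
  assumes x: "x \<in> D'"
  obtains a where "a \<in> D" "pt a = x"
proof -
  interpret I: finitary_perms_iso D' P' D P "inv_into P \<psi>" by (rule inverse_iso)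
  have *: "tr (pt (I.pt x)) (pt (I.pt q)) = tr x q" if q: "q \<in> D'" "q \<noteq> x" for q
  proof -
    have "I.pt x \<noteq> I.pt q" using I.point_inj[OF x q(1)] q(2) by simp
    then have "\<psi> (tr (I.pt x) (I.pt q)) = tr (pt (I.pt x)) (pt (I.pt q))"
      using \<psi>_transpose_pt[OF I.pt(1)[OF x] I.pt(1)[OF q(1)]] by simp
    moreover have "inv_into P \<psi> (tr x q) = tr (I.pt x) (I.pt q)"
      using I.\<psi>_transpose_pt[OF x q(1)] q(2) by simp
    ultimately show ?thesis
      using x q B.transpose_mem bij by (metis bij_betw_inv_into_right)
  qed
  \<comment> \<open>A single q only yields an equality of unordered pairs; two different choices
    leave x as the common element.\<close>
  obtain p where p: "p \<in> D'" "p \<noteq> x" using B.ex_avoiding[of "{x}"] by auto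
  obtain q where q: "q \<in> D'" "q \<noteq> x" "q \<noteq> p" using B.ex_avoiding[of "{x, p}"] by auto
  have "pt (I.pt p) \<noteq> pt (I.pt q)" using p q point_inj I.point_inj I.pt(1) by metis
  moreover have "tr x p x \<noteq> x" "tr x q x \<noteq> x" using p q by auto
  ultimately have "pt (I.pt x) = x"
    unfolding *[OF p, symmetric] *[OF q(1,2), symmetric]
    by (auto simp: tr_def split: if_splits)
  then show ?thesis using that I.pt(1)[OF x] by blast
qed

lemma bij_pt: "bij_betw pt D D'"
  unfolding bij_betw_def inj_on_def
  using point_inj pt(1) pt_surj by (metis (no_types, lifting) image_eqI subsetI image_subsetI subset_antisym)

end

section \<open>Spaces determined by their homeomorphism groups\<close>

definition isolated_points :: "'a topology \<Rightarrow> 'a set" where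
  "isolated_points X = {x. openin X {x}}"

text \<open>Convergence of an unordered set: every injective enumeration of S tends to y. A finite S
  converges to each point of the space, so finitary permutations fall under the same lemmas as
  infinite ones.\<close>

definition converges_to :: "'a topology \<Rightarrow> 'a set \<Rightarrow> 'a \<Rightarrow> bool" where
  "converges_to X S y \<longleftrightarrow>
     y \<in> topspace X \<and> (\<forall>V. openin X V \<and> y \<in> V \<longrightarrow> finite (S - V))"

lemma isolated_points_subset: "isolated_points X \<subseteq> topspace X"
  by (auto simp: isolated_points_def dest: openin_subset)

lemma converges_to_subset: "converges_to X S y \<Longrightarrow> S' \<subseteq> S \<Longrightarrow> converges_to X S' y"
  unfolding converges_to_def by (meson Diff_mono finite_subset subset_refl)

lemma converges_to_limitin:
  assumes "converges_to X S y" "inj f" "range f \<subseteq> S"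
  shows "limitin X f y sequentially"
  unfolding limitin_def
proof (intro conjI allI impI)
  show "y \<in> topspace X" using assms by (simp add: converges_to_def)
  fix V assume V: "openin X V \<and> y \<in> V"
  then have "finite (S - V)" using assms by (simp add: converges_to_def)
  then have "finite (f -` (S - V))" using \<open>inj f\<close> by (rule finite_vimageI)
  moreover have "{n. f n \<notin> V} \<subseteq> f -` (S - V)" using assms by auto
  ultimately have "finite {n. \<not> f n \<in> V}" by (metis finite_subset)
  then show "\<forall>\<^sub>F n in sequentially. f n \<in> V"
    by (simp add: eventually_cofinite flip: cofinite_eq_sequentially)
qed

lemma converges_to_closure:
  assumes "converges_to X S y" "infinite S" "S \<subseteq> topspace X"
  shows "y \<in> X closure_of S"
  unfolding in_closure_of
proof (intro conjI allI impI)
  show "y \<in> topspace X" using assms by (simp add: converges_to_def)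
  fix V assume "y \<in> V \<and> openin X V"
  then have "finite (S - V)" using assms by (simp add: converges_to_def)
  then show "\<exists>z. z \<in> S \<and> z \<in> V" using \<open>infinite S\<close> by (metis Diff_iff finite_subset subsetI)
qed

text \<open>Points of S are isolated. Near a point outside S other than y, only finitely many points
  of S are present and can be cut off, so p is locally the identity. At y, all but finitely many
  points of S have their images in a given neighbourhood, because p is injective.\<close>

lemma permutes_convergent_continuous:
  assumes X: "Hausdorff_space X" and S: "S \<subseteq> isolated_points X"
    and y: "converges_to X S y" and p: "p permutes S"
  shows "continuous_map X X p"
proof -
  have sub: "S \<subseteq> topspace X" using S isolated_points_subset[of X] by blast
  have *: "\<exists>T. openin X T \<and> x \<in> T \<and> T \<subseteq> {x \<in> topspace X. p x \<in> V}"
    if V: "openin X V" and x: "x \<in> topspace X" "p x \<in> V" for V x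
  proof -
    consider "x \<in> S" | "x \<notin> S" "x = y" | "x \<notin> S" "x \<noteq> y" by blast
    then show ?thesis
    proof cases
      case 1
      then have "openin X {x}" using S by (auto simp: isolated_points_def)
      then show ?thesis using x by blast
    next
      case 2
      define F where "F = {s \<in> S. p s \<notin> V}"
      have "p x = x" using p 2 by (simp add: permutes_not_in)
      then have "finite (S - V)" using y V 2 x by (auto simp: converges_to_def)
      moreover have "p ` F \<subseteq> S - V" using permutes_in_image[OF p] by (auto simp: F_def)
      moreover have "inj_on p F" using permutes_inj[OF p] by (rule inj_on_subset) simp
      ultimately have "finite F" by (metis finite_subset finite_imageD)
      then have "closedin X F"
        using X sub by (intro closedin_Hausdorff_finite) (auto simp: F_def)
      then have "openin X (V - F)" using V by (simp add: openin_diff)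
      moreover have "x \<in> V - F" using 2 x \<open>p x = x\<close> by (auto simp: F_def)
      moreover have "V - F \<subseteq> {x \<in> topspace X. p x \<in> V}"
      proof
        fix z assume z: "z \<in> V - F"
        have "p z \<in> V" using z permutes_not_in[OF p, of z] by (cases "z \<in> S") (auto simp: F_def)
        then show "z \<in> {x \<in> topspace X. p x \<in> V}" using z openin_subset[OF V] by auto
      qed
      ultimately show ?thesis by blast
    next
      case 3
      have "y \<in> topspace X" using y by (simp add: converges_to_def)
      then obtain U W where UW: "openin X U" "openin X W" "x \<in> U" "y \<in> W" "disjnt U W"
        using X x 3 unfolding Hausdorff_space_def by metis
      have "finite (S - W)" using y UW by (auto simp: converges_to_def)
      then have "closedin X (S - W)"
        using X sub by (intro closedin_Hausdorff_finite) auto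
      then have "openin X (V \<inter> U - (S - W))" using V UW by (simp add: openin_diff openin_Int)
      moreover have px: "p z = z" if "z \<notin> S" for z using p that by (simp add: permutes_not_in)
      moreover have "x \<in> V \<inter> U - (S - W)" using 3 x UW px by auto
      moreover have "V \<inter> U - (S - W) \<subseteq> {x \<in> topspace X. p x \<in> V}"
      proof
        fix z assume z: "z \<in> V \<inter> U - (S - W)"
        then have "z \<notin> S" using UW by (auto simp: disjnt_iff)
        then show "z \<in> {x \<in> topspace X. p x \<in> V}" using z px openin_subset[OF V] by auto
      qed
      ultimately show ?thesis by blast
    qed
  qed
  have "p x \<in> topspace X" if "x \<in> topspace X" for x
    using that p sub by (metis permutes_in_image permutes_not_in subsetD)
  then show ?thesis
    unfolding continuous_map using * by (metis (mono_tags, lifting) image_subsetI mem_Collect_eq openin_subopen)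
qed

lemma permutes_convergent_homeomorphic:
  assumes "Hausdorff_space X" "S \<subseteq> isolated_points X" "converges_to X S y" "p permutes S"
  shows "homeomorphic_map X X p"
proof -
  have "homeomorphic_maps X X p (inv p)"
    unfolding homeomorphic_maps_def
    using permutes_convergent_continuous[OF assms(1-3)] permutes_inv[OF assms(4)] assms(4)
    by (simp add: permutes_inverses)
  then show ?thesis by (rule homeomorphic_maps_imp_map)
qed

lemma permutes_involution:
  assumes "\<And>x. p (p x) = x" "\<And>x. x \<notin> S \<Longrightarrow> p x = x"
  shows "p permutes S"
  unfolding permutes_def using assms by metis

text \<open>A special case of the extension theorem of Taimanov.\<close>

lemma extend_from_dense_isolated:
  assumes cY: "compact_space Y" and hY: "Hausdorff_space Y"
    and D: "D \<subseteq> isolated_points X" and dense: "X closure_of D = topspace X"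
    and f: "f \<in> D \<rightarrow> topspace Y"
    and sep: "\<And>A B. \<lbrakk>A \<subseteq> D; B \<subseteq> D; Y closure_of (f ` A) \<inter> Y closure_of (f ` B) = {}\<rbrakk>
        \<Longrightarrow> X closure_of A \<inter> X closure_of B = {}"
  obtains F where "continuous_map X Y F" "\<And>x. x \<in> D \<Longrightarrow> F x = f x"
proof -
  have regY: "regular_space Y" using cY hY by (simp add: compact_Hausdorff_imp_regular_space)
  have sub: "D \<subseteq> topspace X" using D isolated_points_subset[of X] by blast
  have cf: "continuous_map (subtopology X D) Y f"
  proof -
    have "openin (subtopology X D) {x}" if "x \<in> D" for x
      using that D unfolding openin_subtopology isolated_points_def by blast
    then have "discrete_topology D = subtopology X D"
      using sub by (auto simp: discrete_topology_unique)
    then have "subtopology X D = discrete_topology D" by (rule sym)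
    then show ?thesis using f by auto
  qed
  have lim: "\<exists>l. limitin Y f l (atin_within X t D)" if t: "t \<in> topspace X - D" for t
  proof (rule ccontr)
    assume "\<nexists>l. limitin Y f l (atin_within X t D)"
    then have "\<exists>U. openin Y U \<and> l \<in> U \<and> \<not> (\<forall>\<^sub>F x in atin_within X t D. f x \<in> U)"
      if "l \<in> topspace Y" for l
      using that unfolding limitin_def by blast
    then obtain U where U: "\<And>l. l \<in> topspace Y \<Longrightarrow> openin Y (U l) \<and> l \<in> U l
        \<and> \<not> (\<forall>\<^sub>F x in atin_within X t D. f x \<in> U l)" by metis
    \<comment> \<open>Regularity puts a closed C between W and \<open>U l\<close>, so the images of
      A and B have disjoint closures, and by \<open>sep\<close> so do A and B. As f is not
      eventually in \<open>U l\<close>, the point t lies in the closure of B, hence not in that of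
      A, and some neighbourhood N of t avoids A.\<close>
    have "\<exists>W N. openin Y W \<and> l \<in> W \<and> openin X N \<and> t \<in> N \<and> (\<forall>x\<in>N \<inter> D. f x \<notin> W)"
      if l: "l \<in> topspace Y" for l
    proof -
      obtain W C where WC: "openin Y W" "closedin Y C" "l \<in> W" "W \<subseteq> C" "C \<subseteq> U l"
        using regY U[OF l] by (metis neighbourhood_base_of neighbourhood_base_of_closedin)
      define A where "A = {x \<in> D. f x \<in> W}"
      define B where "B = {x \<in> D. f x \<notin> U l}"
      have "Y closure_of (f ` A) \<subseteq> C"
        using WC by (intro closure_of_minimal) (auto simp: A_def)
      moreover have "Y closure_of (f ` B) \<subseteq> topspace Y - U l"
        using U[OF l] f by (intro closure_of_minimal) (auto simp: B_def)
      ultimately have "X closure_of A \<inter> X closure_of B = {}"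
        using WC by (intro sep) (auto simp: A_def B_def)
      moreover have "t \<in> X closure_of B"
        unfolding in_closure_of
      proof (intro conjI allI impI)
        fix T assume "t \<in> T \<and> openin X T"
        then show "\<exists>y. y \<in> B \<and> y \<in> T"
          using U[OF l] t by (auto simp: eventually_atin_within B_def)
      qed (use t in auto)
      ultimately have "t \<notin> X closure_of A" by blast
      then obtain N where "openin X N" "t \<in> N" "\<forall>x\<in>A. x \<notin> N"
        using t by (auto simp: in_closure_of)
      then show ?thesis using WC by (auto simp: A_def)
    qed
    then obtain W N where WN: "\<And>l. l \<in> topspace Y \<Longrightarrow> openin Y (W l) \<and> l \<in> W l \<and> openin X (N l)
        \<and> t \<in> N l \<and> (\<forall>x\<in>N l \<inter> D. f x \<notin> W l)" by metis
    \<comment> \<open>Finitely many of the W cover Y, so f would have no possible value on D within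
      the intersection M of the corresponding N, although D is dense.\<close>
    have "\<forall>V\<in>W ` topspace Y. openin Y V" "topspace Y \<subseteq> \<Union> (W ` topspace Y)"
      using WN by blast+
    then obtain \<F> where "finite \<F>" "\<F> \<subseteq> W ` topspace Y" "topspace Y \<subseteq> \<Union>\<F>"
      using cY unfolding compact_space_alt by metis
    then obtain L where L: "finite L" "L \<subseteq> topspace Y" "topspace Y \<subseteq> \<Union> (W ` L)"
      by (metis finite_subset_image)
    define M where "M = topspace X \<inter> \<Inter> (N ` L)"
    have "openin X M"
      using L WN unfolding M_def by (intro openin_Int_Inter) auto
    moreover have "t \<in> M" using t WN L by (auto simp: M_def)
    moreover have "t \<in> X closure_of D" using t dense by simp
    ultimately obtain x where x: "x \<in> D" "x \<in> M" by (metis in_closure_of)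
    then obtain l where "l \<in> L" "f x \<in> W l" using f L by blast
    then show False using WN x L by (auto simp: M_def)
  qed
  obtain F where "continuous_map (subtopology X (topspace X)) Y F" "\<And>x. x \<in> D \<Longrightarrow> F x = f x"
    using continuous_map_extension_pointwise_alt[OF regY sub _ cf lim] dense by (metis order_refl)
  then show ?thesis using that by simp
qed

text \<open>In the last assumption both sets accumulate at the same point, although not
  necessarily at x.\<close>

locale interleaved_space =
  fixes X :: "'a topology"
  assumes nonempty: "topspace X \<noteq> {}"
    and compact: "compact_space X"
    and Hausdorff: "Hausdorff_space X"
    and dense: "X closure_of isolated_points X = topspace X"
    and interleave: "\<lbrakk>A \<subseteq> isolated_points X; B \<subseteq> isolated_points X;
          x \<in> X closure_of A; x \<in> X closure_of B; x \<notin> isolated_points X\<rbrakk>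
        \<Longrightarrow> \<exists>S T y. S \<subseteq> A \<and> T \<subseteq> B \<and> infinite S \<and> infinite T \<and> converges_to X (S \<union> T) y"
begin

abbreviation "D \<equiv> isolated_points X"

text \<open>Homeomorphisms are extensional on the space, permutations are the identity off D; this
  passes from the first format to the second and loses nothing because D is dense.\<close>

definition on_isolated :: "('a \<Rightarrow> 'a) \<Rightarrow> 'a \<Rightarrow> 'a" where
  "on_isolated h x = (if x \<in> D then h x else x)"

definition isolated_perms :: "('a \<Rightarrow> 'a) set" where
  "isolated_perms = on_isolated ` homeo_group X"

text \<open>By Bolzano-Weierstrass an infinite S accumulates somewhere, necessarily outside D; then
  S is interleaved with itself.\<close>

lemma ex_convergent:
  assumes "S \<subseteq> D" "infinite S"
  obtains S' y where "S' \<subseteq> S" "infinite S'" "converges_to X S' y"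
proof -
  obtain x where x: "x \<in> X derived_set_of S"
    using compactin_imp_Bolzano_Weierstrass[of X "topspace X" S] assms compact
      isolated_points_subset[of X] by (auto simp: compact_space_def)
  have "x \<notin> D"
  proof
    assume "x \<in> D"
    then obtain z where "z \<noteq> x" "z \<in> {x}"
      using x unfolding isolated_points_def in_derived_set_of by blast
    then show False by simp
  qed
  moreover have "x \<in> X closure_of S"
    using x by (simp add: closure_of_alt)
  ultimately show ?thesis
    using interleave[of S S x] assms that converges_to_subset by (metis sup_ge1)
qed

lemma homeo_groupD:
  assumes "h \<in> homeo_group X"
  shows "homeomorphic_map X X h" "continuous_map X X h" "h \<in> extensional (topspace X)"
    "inj_on h (topspace X)" "h ` topspace X = topspace X"
  using assms by (auto simp: homeo_group_def homeomorphic_imp_continuous_map PiE_def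
      homeomorphic_imp_injective_map homeomorphic_imp_surjective_map)

lemma homeo_groupI:
  assumes "homeomorphic_map X X h"
  shows "restrict h (topspace X) \<in> homeo_group X"
proof -
  have "homeomorphic_map X X (restrict h (topspace X))"
    using assms by (rule homeomorphic_map_eq) auto
  then show ?thesis
    using homeomorphic_imp_surjective_map[OF assms] by (auto simp: homeo_group_def)
qed

lemma compose_mem:
  assumes "g \<in> homeo_group X" "h \<in> homeo_group X"
  shows "compose (topspace X) g h \<in> homeo_group X"
  using homeo_groupI[OF homeomorphic_map_compose[OF homeo_groupD(1)[OF assms(2)] homeo_groupD(1)[OF assms(1)]]]
  by (simp add: compose_def restrict_def comp_def)

lemma on_isolated_permutes:
  assumes h: "h \<in> homeo_group X"
  shows "on_isolated h permutes D"
proof (rule bij_imp_permutes)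
  note * = homeo_groupD[OF h]
  have D: "D \<subseteq> topspace X" by (rule isolated_points_subset)
  have "h x \<in> D" if x: "x \<in> D" for x
  proof -
    have "openin X (h ` {x})"
      using homeomorphic_imp_open_map[OF *(1)] x unfolding open_map_def isolated_points_def by blast
    then show ?thesis by (simp add: isolated_points_def)
  qed
  moreover have "y \<in> h ` D" if y: "y \<in> D" for y
  proof -
    obtain x where x: "x \<in> topspace X" "y = h x" using y D * by blast
    have "openin X {z \<in> topspace X. h z \<in> {y}}"
      using y *(2) unfolding isolated_points_def by (metis mem_Collect_eq openin_continuous_map_preimage)
    moreover have "{z \<in> topspace X. h z \<in> {y}} = {x}" using x *(4) by (auto simp: inj_on_def)
    ultimately show ?thesis using x by (auto simp: isolated_points_def)
  qed
  ultimately have "h ` D = D" by blast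
  then have "bij_betw h D D" using *(4) D by (auto simp: bij_betw_def intro: inj_on_subset)
  then show "bij_betw (on_isolated h) D D"
    by (subst bij_betw_cong[of D _ h]) (auto simp: on_isolated_def)
qed (simp add: on_isolated_def)

lemma on_isolated_inj: "inj_on on_isolated (homeo_group X)"
proof (rule inj_onI)
  fix g h assume gh: "g \<in> homeo_group X" "h \<in> homeo_group X" and eq: "on_isolated g = on_isolated h"
  have "g x = h x" if "x \<in> D" for x
    using fun_cong[OF eq, of x] that by (simp add: on_isolated_def)
  then have "g x = h x" if "x \<in> topspace X" for x
    using forall_in_closure_of_eq[of x X D X g h] Hausdorff homeo_groupD(2)[OF gh(1)]
      homeo_groupD(2)[OF gh(2)] that by (simp add: dense)
  then show "g = h" using gh homeo_groupD(3) by (metis extensionalityI)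
qed

lemma on_isolated_compose:
  assumes "g \<in> homeo_group X" "h \<in> homeo_group X"
  shows "on_isolated (compose (topspace X) g h) = on_isolated g \<circ> on_isolated h"
proof
  fix x
  show "on_isolated (compose (topspace X) g h) x = (on_isolated g \<circ> on_isolated h) x"
    using permutes_in_image[OF on_isolated_permutes[OF assms(2)], of x] isolated_points_subset[of X]
    by (auto simp: on_isolated_def compose_def)
qed

lemma convergent_perm:
  assumes "S \<subseteq> D" "converges_to X S y" "p permutes S"
  shows "restrict p (topspace X) \<in> homeo_group X"
    and "on_isolated (restrict p (topspace X)) = p"
proof -
  show "restrict p (topspace X) \<in> homeo_group X"
    using permutes_convergent_homeomorphic[OF Hausdorff assms] by (rule homeo_groupI)
  show "on_isolated (restrict p (topspace X)) = p"
  proof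
    fix x
    show "on_isolated (restrict p (topspace X)) x = p x"
    proof (cases "x \<in> D")
      case False
      then have "p x = x" using permutes_not_in[OF assms(3), of x] assms(1) by blast
      then show ?thesis using False by (simp add: on_isolated_def)
    qed (use isolated_points_subset[of X] in \<open>auto simp: on_isolated_def\<close>)
  qed
qed

lemma finite_perm_mem:
  assumes "finite S" "S \<subseteq> D" "p permutes S"
  shows "p \<in> isolated_perms"
proof -
  obtain y where "y \<in> topspace X" using nonempty by blast
  then have "converges_to X S y" using assms by (simp add: converges_to_def)
  then show ?thesis using convergent_perm[OF assms(2) _ assms(3)] unfolding isolated_perms_def by (metis imageI)
qed

lemma finitary_perms_isolated_perms:
  assumes "infinite D"
  shows "finitary_perms D isolated_perms"
proof
  fix p q assume "p \<in> isolated_perms" "q \<in> isolated_perms"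
  then show "p \<circ> q \<in> isolated_perms"
    unfolding isolated_perms_def
    by (auto simp: compose_mem simp flip: on_isolated_compose)
next
  fix a b assume "a \<in> D" "b \<in> D"
  then show "tr a b \<in> isolated_perms"
    by (intro finite_perm_mem[of "{a, b}"] permutes_swap_id) auto
qed (use assms on_isolated_permutes in \<open>auto simp: isolated_perms_def\<close>)

lemma infinite_isolated_perms:
  assumes "infinite D"
  shows "infinite isolated_perms"
proof -
  interpret finitary_perms D isolated_perms using assms by (rule finitary_perms_isolated_perms)
  obtain a where a: "a \<in> D" using ex_avoiding[of "{}"] by blast
  have "tr a ` D \<subseteq> isolated_perms" using a transpose_mem by auto
  moreover have "inj_on (tr a) D" by (rule inj_onI) (metis transpose_apply_first)
  ultimately show ?thesis using assms by (metis finite_imageD finite_subset)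
qed

text \<open>A finite D is closed as well as dense, hence the whole space, and the group is the full
  symmetric group.\<close>

lemma isolated_perms_finite:
  assumes "finite D"
  shows "isolated_perms = {p. p permutes D}" "topspace X = D"
proof -
  show "isolated_perms = {p. p permutes D}"
    using assms finite_perm_mem on_isolated_permutes by (auto simp: isolated_perms_def)
  have "closedin X D"
    using assms Hausdorff isolated_points_subset by (intro closedin_Hausdorff_finite)
  then show "topspace X = D" using dense by (simp add: closure_of_closedin)
qed

end

section \<open>Continuous extension of the bijection between isolated points\<close>

lemma swap_evens:
  fixes s t :: "nat \<Rightarrow> 'a"
  assumes "inj s" "inj t" and st: "\<And>m n. s m \<noteq> t n"
  obtains \<pi> where "\<And>z. \<pi> (\<pi> z) = z" "\<And>n. \<pi> (s (2*n)) = t (2*n)"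
    "\<And>n. \<pi> (s (Suc (2*n))) = s (Suc (2*n))" "\<And>z. z \<notin> range s \<union> range t \<Longrightarrow> \<pi> z = z"
    "\<And>z. \<pi> z \<in> insert z (range s \<union> range t)"
proof -
  define \<pi> where "\<pi> z = (if z \<in> s ` {n. even n} then t (inv s z)
      else if z \<in> t ` {n. even n} then s (inv t z) else z)" for z
  have ts: "t m \<noteq> s n" for m n using st by metis
  have \<pi>s: "\<pi> (s n) = (if even n then t n else s n)" for n
    using assms by (auto simp: \<pi>_def inj_eq)
  have \<pi>t: "\<pi> (t n) = (if even n then s n else t n)" for n
    using assms ts by (auto simp: \<pi>_def inj_eq)
  have \<pi>o: "\<pi> z = z" if "z \<notin> range s \<union> range t" for z
    using that by (auto simp: \<pi>_def)
  have "\<pi> (\<pi> z) = z" "\<pi> z \<in> insert z (range s \<union> range t)" for z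
  proof -
    consider n where "z = s n" | n where "z = t n" | "z \<notin> range s \<union> range t" by blast
    then have "\<pi> (\<pi> z) = z \<and> \<pi> z \<in> insert z (range s \<union> range t)"
      by cases (simp_all add: \<pi>s \<pi>t \<pi>o)
    then show "\<pi> (\<pi> z) = z" "\<pi> z \<in> insert z (range s \<union> range t)" by auto
  qed
  then show ?thesis using that[of \<pi>] \<pi>o by (simp add: \<pi>s)
qed

text \<open>Transport of homeomorphisms from X to Y yields continuity in the same direction. The
  separation condition of the extension lemma is proved in contrapositive form as
  \<open>meet\<close>: closures that meet in X have images whose closures meet in Y.\<close>

lemma extend_induced:
  assumes "interleaved_space X" "interleaved_space Y"
    and b: "bij_betw b (isolated_points X) (isolated_points Y)"
    and ind: "\<And>h. h \<in> homeo_group X \<Longrightarrow> \<exists>h'\<in>homeo_group Y. \<forall>a\<in>isolated_points X. h' (b a) = b (h a)"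
  obtains F where "continuous_map X Y F" "\<And>x. x \<in> isolated_points X \<Longrightarrow> F x = b x"
proof -
  interpret A: interleaved_space X by fact
  interpret B: interleaved_space Y by fact
  have binj: "inj_on b A.D" and bim: "b ` A.D = B.D" using b by (auto simp: bij_betw_def)
  have Bsub: "B.D \<subseteq> topspace Y" by (rule isolated_points_subset)
  have meet: "Y closure_of (b ` A) \<inter> Y closure_of (b ` B) \<noteq> {}"
    if AB: "A \<subseteq> A.D" "B \<subseteq> A.D" and x: "x \<in> X closure_of A" "x \<in> X closure_of B" for A B x
  proof (cases "x \<in> A.D")
    case True
    then have "openin X {x}" by (simp add: isolated_points_def)
    then have "x \<in> A \<inter> B" using x unfolding in_closure_of by (metis IntI singletonD singletonI)
    then have "b x \<in> b ` A" "b x \<in> b ` B" by auto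
    moreover have "b ` A \<subseteq> topspace Y" "b ` B \<subseteq> topspace Y" using AB bim Bsub by auto
    ultimately show ?thesis
      using closure_of_subset[of "b ` A" Y] closure_of_subset[of "b ` B" Y] by blast
  next
    case False
    obtain S T y where ST: "S \<subseteq> A" "T \<subseteq> B" "infinite S" "infinite T" "converges_to X (S \<union> T) y"
      using A.interleave[OF AB x False] by blast
    have inf: "infinite (b ` S)" "infinite (b ` T)"
      using ST(1-4) AB finite_image_iff[OF inj_on_subset[OF binj]] by (meson subset_trans)+
    have subD: "b ` S \<subseteq> B.D" "b ` T \<subseteq> B.D" using ST(1,2) AB unfolding bim[symmetric] by blast+
    \<comment> \<open>Nothing is known yet about b and limits, so only infinite parts of the two
      images are made to converge, and their limits x' and y' may differ a priori.\<close>
    obtain S' x' where S': "S' \<subseteq> b ` S" "infinite S'" "converges_to Y S' x'"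
      using B.ex_convergent[OF subD(1) inf(1)] by metis
    obtain T' y' where T': "T' \<subseteq> b ` T" "infinite T'" "converges_to Y T' y'"
      using B.ex_convergent[OF subD(2) inf(2)] by metis
    have "x' = y'"
    proof (rule ccontr)
      assume ne: "x' \<noteq> y'"
      have "x' \<in> topspace Y" "y' \<in> topspace Y" using S' T' by (auto simp: converges_to_def)
      then obtain V W where VW: "openin Y V" "openin Y W" "x' \<in> V" "y' \<in> W" "disjnt V W"
        using B.Hausdorff ne unfolding Hausdorff_space_def by metis
      have "finite (S' - V)" "finite (T' - W)"
        using S' T' VW by (auto simp: converges_to_def)
      then have "infinite (S' \<inter> V)" "infinite (T' \<inter> W)"
        using S' T' by (metis Diff_Diff_Int Diff_infinite_finite)+
      then obtain s t :: "nat \<Rightarrow> 'b" where s: "inj s" "range s \<subseteq> S' \<inter> V"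
        and t: "inj t" "range t \<subseteq> T' \<inter> W"
        by (meson infinite_countable_subset)
      have st: "s m \<noteq> t n" for m n
      proof -
        have "s m \<in> V" "t n \<in> W" using s t by blast+
        then show ?thesis using VW(5) by (metis disjnt_iff)
      qed
      \<comment> \<open>Even terms of s are exchanged with those of t and odd terms stay fixed, so a
        continuous extension would have to send x' both to y' and to itself.\<close>
      obtain \<pi> where \<pi>\<pi>: "\<And>z. \<pi> (\<pi> z) = z" and \<pi>s: "\<And>n. \<pi> (s (2*n)) = t (2*n)"
        and \<pi>o: "\<And>n. \<pi> (s (Suc (2*n))) = s (Suc (2*n))"
        and \<pi>id: "\<And>z. z \<notin> range s \<union> range t \<Longrightarrow> \<pi> z = z"
        and \<pi>in: "\<And>z. \<pi> z \<in> insert z (range s \<union> range t)"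
        using swap_evens[OF s(1) t(1) st] by blast
      have rng: "range s \<subseteq> S'" "range t \<subseteq> T'" "range s \<subseteq> B.D" "range t \<subseteq> B.D"
        using s(2) t(2) S'(1) T'(1) subD by blast+
      have \<pi>D: "\<pi> z \<in> B.D" if "z \<in> B.D" for z
        using that rng(3,4) \<pi>in[of z] by (metis UnE insertE subsetD)
      define c where "c = inv_into A.D b"
      have c: "c z \<in> A.D" "b (c z) = z" if "z \<in> B.D" for z
        using that bim by (auto simp: c_def inv_into_into f_inv_into_f)
      have cb: "c (b a) = a" if "a \<in> A.D" for a using that binj by (simp add: c_def)
      have bD: "b a \<in> B.D" if "a \<in> A.D" for a using that bim by auto
      \<comment> \<open>The swap pulled back to X along b. Its support lies in S \<union> T, which
        converges to the single point y, so p gives a homeomorphism of X; the map h' that it induces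
        on Y agrees with \<pi> on the isolated points.\<close>
      define p where "p a = (if a \<in> A.D then c (\<pi> (b a)) else a)" for a
      have STD: "S \<union> T \<subseteq> A.D" using ST AB by blast
      have "p permutes (S \<union> T)"
      proof (rule permutes_involution)
        show "p (p a) = a" for a by (simp add: p_def c \<pi>D bD \<pi>\<pi> cb)
        fix a assume a: "a \<notin> S \<union> T"
        have "b a \<notin> S' \<union> T'" if "a \<in> A.D"
        proof
          assume "b a \<in> S' \<union> T'"
          then have "b a \<in> b ` (S \<union> T)" using S'(1) T'(1) by blast
          then show False using inj_on_image_mem_iff[OF binj that STD] a by simp
        qed
        then have "\<pi> (b a) = b a" if "a \<in> A.D"
          using that \<pi>id[of "b a"] rng(1,2) by (meson UnE UnI1 UnI2 subsetD)
        then show "p a = a" by (simp add: p_def cb)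
      qed
      then have "restrict p (topspace X) \<in> homeo_group X"
        using A.convergent_perm[OF STD ST(5)] by blast
      then obtain h' where h': "h' \<in> homeo_group Y"
        "\<And>a. a \<in> A.D \<Longrightarrow> h' (b a) = b (restrict p (topspace X) a)"
        using ind by blast
      have hpi: "h' z = \<pi> z" if z: "z \<in> B.D" for z
      proof -
        have "h' z = b (p (c z))"
          using h'(2)[OF c(1)[OF z]] c[OF z] isolated_points_subset[of X] by auto
        then show ?thesis by (simp add: p_def c z \<pi>D)
      qed
      have inD: "s n \<in> B.D" "t n \<in> B.D" for n by (simp_all add: subsetD[OF rng(3)] subsetD[OF rng(4)])
      have ss: "limitin Y (s \<circ> r) x' sequentially" "limitin Y (t \<circ> r) y' sequentially"
        if "inj r" for r
      proof -
        show "limitin Y (s \<circ> r) x' sequentially"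
          by (rule converges_to_limitin[OF S'(3) inj_compose[OF s(1) that]]) (use rng(1) in auto)
        show "limitin Y (t \<circ> r) y' sequentially"
          by (rule converges_to_limitin[OF T'(3) inj_compose[OF t(1) that]]) (use rng(2) in auto)
      qed
      have inj: "inj (\<lambda>n::nat. 2*n)" "inj (\<lambda>n::nat. Suc (2*n))" by (auto simp: inj_def)
      have "limitin Y (h' \<circ> (s \<circ> (\<lambda>n. 2*n))) (h' x') sequentially"
        using continuous_map_limit[OF B.homeo_groupD(2)[OF h'(1)] ss(1)[OF inj(1)]] .
      moreover have "h' \<circ> (s \<circ> (\<lambda>n. 2*n)) = t \<circ> (\<lambda>n. 2*n)"
        by (simp add: fun_eq_iff hpi inD \<pi>s)
      ultimately have 1: "h' x' = y'"
        using limitin_Hausdorff_unique[OF _ ss(2)[OF inj(1)] sequentially_bot B.Hausdorff] by simp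
      have l2: "limitin Y (h' \<circ> (s \<circ> (\<lambda>n. Suc (2*n)))) (h' x') sequentially"
        using continuous_map_limit[OF B.homeo_groupD(2)[OF h'(1)] ss(1)[OF inj(2)]] .
      have e2: "h' \<circ> (s \<circ> (\<lambda>n. Suc (2*n))) = s \<circ> (\<lambda>n. Suc (2*n))"
        by (simp add: fun_eq_iff hpi inD \<pi>o)
      have "h' x' = x'"
        by (rule limitin_Hausdorff_unique[OF l2[unfolded e2] ss(1)[OF inj(2)] sequentially_bot B.Hausdorff])
      then show False using 1 ne by simp
    qed
    moreover have "S' \<subseteq> topspace Y" "T' \<subseteq> topspace Y"
      by (rule subset_trans[OF S'(1) subset_trans[OF subD(1) Bsub]])
        (rule subset_trans[OF T'(1) subset_trans[OF subD(2) Bsub]])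
    then have "x' \<in> Y closure_of S'" "y' \<in> Y closure_of T'"
      using converges_to_closure[OF S'(3,2)] converges_to_closure[OF T'(3,2)] by simp_all
    moreover have "S' \<subseteq> b ` A" "T' \<subseteq> b ` B" using S'(1) T'(1) image_mono[OF ST(1), of b] image_mono[OF ST(2), of b] by simp_all
    ultimately show ?thesis
      using closure_of_mono[of S' "b ` A" Y] closure_of_mono[of T' "b ` B" Y] by blast
  qed
  show ?thesis
  proof (rule extend_from_dense_isolated[OF B.compact B.Hausdorff subset_refl A.dense])
    show "b \<in> A.D \<rightarrow> topspace Y" using bim Bsub by auto
    show "X closure_of A \<inter> X closure_of B = {}"
      if "A \<subseteq> A.D" "B \<subseteq> A.D" "Y closure_of (b ` A) \<inter> Y closure_of (b ` B) = {}" for A B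
      using meet that by blast
  qed (use that in blast)
qed

theorem interleaved_spaces_homeomorphic:
  assumes "interleaved_space X" "interleaved_space Y"
    and bij: "bij_betw \<phi> (homeo_group X) (homeo_group Y)"
    and hom: "\<And>g h. g \<in> homeo_group X \<Longrightarrow> h \<in> homeo_group X \<Longrightarrow>
        \<phi> (compose (topspace X) g h) = compose (topspace Y) (\<phi> g) (\<phi> h)"
  shows "X homeomorphic_space Y"
proof -
  interpret A: interleaved_space X by fact
  interpret B: interleaved_space Y by fact
  define i where "i = inv_into (homeo_group X) A.on_isolated"
  define \<psi> where "\<psi> = B.on_isolated \<circ> \<phi> \<circ> i"
  have bi: "bij_betw i A.isolated_perms (homeo_group X)"
    unfolding i_def A.isolated_perms_def
    by (intro bij_betw_inv_into) (simp add: bij_betw_def A.on_isolated_inj)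
  have bpsi: "bij_betw \<psi> A.isolated_perms B.isolated_perms"
    unfolding \<psi>_def
    by (intro bij_betw_trans[OF bi] bij_betw_trans[OF bij])
      (simp add: bij_betw_def B.on_isolated_inj B.isolated_perms_def)
  have \<phi>_mem: "\<phi> h \<in> homeo_group Y" if "h \<in> homeo_group X" for h
    using that bij by (auto simp: bij_betw_def)
  have i: "i (A.on_isolated h) = h" if "h \<in> homeo_group X" for h
    using that A.on_isolated_inj by (simp add: i_def)
  have \<psi>: "\<psi> (A.on_isolated h) = B.on_isolated (\<phi> h)" if "h \<in> homeo_group X" for h
    using that by (simp add: \<psi>_def i)
  show ?thesis
  proof (cases "finite A.D")
    case True
    have "finite B.D"
      using B.infinite_isolated_perms bij_betw_finite[OF bpsi] A.isolated_perms_finite[OF True]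
        finite_permutations[OF True] by metis
    note AB = A.isolated_perms_finite[OF True] B.isolated_perms_finite[OF this]
    have "fact (card A.D) = (fact (card B.D) :: nat)"
      using bij_betw_same_card[OF bpsi] card_permutations[OF refl True]
        card_permutations[OF refl \<open>finite B.D\<close>] AB(1,3) by metis
    \<comment> \<open>Since 0! = 1!, the factorial is injective only on positive numbers.\<close>
    moreover have "card A.D > 0" "card B.D > 0"
      using True \<open>finite B.D\<close> A.nonempty B.nonempty AB by (auto simp: card_gt_0_iff)
    ultimately have "card A.D = card B.D"
      by (metis fact_less_mono_nat linorder_neqE_nat less_irrefl)
    then obtain f where f: "bij_betw f A.D B.D"
      using True \<open>finite B.D\<close> by (metis finite_same_card_bij)
    have "X = discrete_topology A.D" "Y = discrete_topology B.D"
      using AB by (auto simp: discrete_topology_unique isolated_points_def eq_commute[of X] eq_commute[of Y])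
    moreover have "homeomorphic_maps (discrete_topology A.D) (discrete_topology B.D) f (inv_into A.D f)"
      using f bij_betw_inv_into[OF f]
      by (auto simp: homeomorphic_maps_def bij_betw_def f_inv_into_f)
    ultimately show ?thesis unfolding homeomorphic_space_def by metis
  next
    case False
    have infB: "infinite B.D"
      using A.infinite_isolated_perms[OF False] bij_betw_finite[OF bpsi] B.isolated_perms_finite
        finite_permutations by metis
    interpret I: finitary_perms_iso A.D A.isolated_perms B.D B.isolated_perms \<psi>
    proof (intro finitary_perms_iso.intro A.finitary_perms_isolated_perms[OF False]
        B.finitary_perms_isolated_perms[OF infB] finitary_perms_iso_axioms.intro bpsi)
      fix p q assume "p \<in> A.isolated_perms" "q \<in> A.isolated_perms"
      then obtain g h where "p = A.on_isolated g" "q = A.on_isolated h"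
        "g \<in> homeo_group X" "h \<in> homeo_group X" by (auto simp: A.isolated_perms_def)
      then show "\<psi> (p \<circ> q) = \<psi> p \<circ> \<psi> q"
        by (simp add: \<psi> A.compose_mem hom B.on_isolated_compose \<phi>_mem
            flip: A.on_isolated_compose)
    qed
    have ind: "\<phi> h (I.pt a) = I.pt (h a)" if "h \<in> homeo_group X" "a \<in> A.D" for h a
    proof -
      have "\<psi> (A.on_isolated h) (I.pt a) = I.pt (A.on_isolated h a)"
        using that by (intro I.\<psi>_apply_pt) (auto simp: A.isolated_perms_def)
      then show ?thesis
        using that I.pt(1) by (simp add: \<psi> A.on_isolated_def B.on_isolated_def)
    qed
    obtain F where F: "continuous_map X Y F" "\<And>x. x \<in> A.D \<Longrightarrow> F x = I.pt x"
      using extend_induced[OF assms(1,2) I.bij_pt] ind \<phi>_mem by metis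
    define c where "c = inv_into A.D I.pt"
    have c: "c z \<in> A.D" "I.pt (c z) = z" if "z \<in> B.D" for z
      using that I.bij_pt by (auto simp: c_def bij_betw_def inv_into_into f_inv_into_f)
    have cb: "c (I.pt a) = a" if "a \<in> A.D" for a
      using that I.bij_pt by (simp add: c_def bij_betw_def)
    \<comment> \<open>As \<phi> is onto, h' is some \<open>\<phi> h\<close>; equivariance of
      \<open>I.pt\<close> read backwards is the hypothesis of \<open>extend_induced\<close> for the
      inverse bijection.\<close>
    have "\<exists>h\<in>homeo_group X. \<forall>z\<in>B.D. h (c z) = c (h' z)" if h': "h' \<in> homeo_group Y" for h'
    proof -
      obtain h where h: "h \<in> homeo_group X" "h' = \<phi> h" using h' bij by (auto simp: bij_betw_def)
      have "h (c z) = c (h' z)" if z: "z \<in> B.D" for z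
      proof -
        have "h (c z) \<in> A.D"
          using permutes_in_image[OF A.on_isolated_permutes[OF h(1)], of "c z"] c(1)[OF z]
          by (simp add: A.on_isolated_def)
        then show ?thesis using ind[OF h(1) c(1)[OF z]] c[OF z] h cb by metis
      qed
      then show ?thesis using h by blast
    qed
    then obtain F' where F': "continuous_map Y X F'" "\<And>x. x \<in> B.D \<Longrightarrow> F' x = c x"
      using extend_induced[OF assms(2,1), of c] bij_betw_inv_into[OF I.bij_pt] c_def by metis
    have "(F' \<circ> F) x = id x" if "x \<in> X closure_of A.D" for x
      using that A.Hausdorff continuous_map_compose[OF F(1) F'(1)] continuous_map_id
      by (rule forall_in_closure_of_eq) (use F F' cb I.pt(1) in auto)
    moreover have "(F \<circ> F') x = id x" if "x \<in> Y closure_of B.D" for x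
      using that B.Hausdorff continuous_map_compose[OF F'(1) F(1)] continuous_map_id
      by (rule forall_in_closure_of_eq) (use F F' c in auto)
    ultimately have "homeomorphic_maps X Y F F'"
      using F F' A.dense B.dense by (simp add: homeomorphic_maps_def)
    then show ?thesis unfolding homeomorphic_space_def by blast
  qed
qed

section \<open>Ordinal spaces\<close>

locale well_order_space =
  fixes r :: "'a rel"
  assumes well_order: "Well_order r"
begin

abbreviation "C \<equiv> ord_carrier r"
abbreviation "X \<equiv> ord_space r"
abbreviation "lt \<equiv> ord_lt r"

definition le :: "'a option \<Rightarrow> 'a option \<Rightarrow> bool" where
  "le x y \<longleftrightarrow> x = y \<or> lt x y"

lemma lt_irrefl [simp]: "\<not> lt x x"
  by (cases x) (auto simp: ord_lt_def)

lemma lt_trans: "lt x y \<Longrightarrow> lt y z \<Longrightarrow> lt x z"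
proof -
  have "trans r" "antisym r"
    using well_order by (auto simp: order_on_defs)
  then show "lt x y \<Longrightarrow> lt y z \<Longrightarrow> lt x z"
    by (auto simp: ord_lt_def split: option.splits dest: transD antisymD)
qed

lemma lt_asym: "lt x y \<Longrightarrow> \<not> lt y x"
  using lt_trans lt_irrefl by blast

lemma lt_total:
  assumes "x \<in> C" "y \<in> C" "x \<noteq> y"
  shows "lt x y \<or> lt y x"
proof -
  have "total_on (Field r) r" using well_order by (auto simp: order_on_defs)
  then show ?thesis
    using assms by (auto simp: ord_lt_def ord_carrier_def total_on_def split: option.splits)
qed

lemma not_lt: "x \<in> C \<Longrightarrow> y \<in> C \<Longrightarrow> \<not> lt x y \<longleftrightarrow> le y x"
  using lt_total lt_asym by (auto simp: le_def)

lemma le_lt_trans: "le x y \<Longrightarrow> lt y z \<Longrightarrow> lt x z"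
  and lt_le_trans: "lt x y \<Longrightarrow> le y z \<Longrightarrow> lt x z"
  and le_refl [simp]: "le x x"
  using lt_trans by (auto simp: le_def)

lemma None_mem [simp]: "None \<in> C"
  by (simp add: ord_carrier_def)

lemma le_None: "le x None"
  by (cases x) (auto simp: le_def ord_lt_def)

lemma ex_least:
  assumes "A \<subseteq> C" "A \<noteq> {}"
  obtains m where "m \<in> A" "\<And>x. x \<in> A \<Longrightarrow> le m x"
proof -
  have wf: "wf (r - Id)" using well_order by (auto simp: order_on_defs well_order_on_def)
  have "\<exists>m\<in>A. \<forall>x\<in>A. \<not> lt x m"
  proof (cases "\<exists>a. Some a \<in> A")
    case True
    then obtain a where "a \<in> {a. Some a \<in> A}" by blast
    then obtain m where m: "m \<in> {a. Some a \<in> A}"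
      "\<And>y. (y, m) \<in> r - Id \<Longrightarrow> y \<notin> {a. Some a \<in> A}"
      using wfE_min[OF wf] by metis
    have "\<not> lt x (Some m)" if "x \<in> A" for x
      using m(2) that by (cases x) (auto simp: ord_lt_def)
    then show ?thesis using m(1) by blast
  next
    case False
    then have "A = {None}" using assms by (metis all_not_in_conv not_None_eq subset_singletonD subsetI singletonI)
    then show ?thesis by simp
  qed
  then show ?thesis using that not_lt assms by (meson subsetD)
qed

lemma topspace: "topspace X = C"
  by (auto simp: ord_space_def topology_generated_by_topspace)

lemma openin_less: "a \<in> C \<Longrightarrow> openin X {x \<in> C. lt x a}"
  and openin_greater: "a \<in> C \<Longrightarrow> openin X {x \<in> C. lt a x}"
  unfolding ord_space_def by (rule topology_generated_by_Basis; blast)+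

text \<open>Unless a is the greatest point, there is a least b above it, and then x \<le> a means
  the same as x < b. Well-ordering enters here; together with \<open>openin_greater\<close> it makes
  these segments clopen.\<close>

lemma openin_le:
  assumes a: "a \<in> C"
  shows "openin X {x \<in> C. le x a}"
proof (cases "{b \<in> C. lt a b} = {}")
  case True
  then have "{x \<in> C. le x a} = C" using a not_lt by blast
  then show ?thesis using topspace by (metis openin_topspace)
next
  case False
  then obtain b where "b \<in> {b \<in> C. lt a b}"
    and least: "\<And>x. x \<in> {b \<in> C. lt a b} \<Longrightarrow> le b x"
    using ex_least[of "{b \<in> C. lt a b}"] by auto
  then have b: "b \<in> C" "lt a b" by auto
  have "le x a \<longleftrightarrow> lt x b" if "x \<in> C" for x
    using least[of x] b(2) that not_lt[OF a that] not_lt[OF that b(1)] le_lt_trans by auto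
  then have "{x \<in> C. le x a} = {x \<in> C. lt x b}" by blast
  then show ?thesis using openin_less b by simp
qed

text \<open>The segments up to p are open, so only what lies below p matters. The first alternative
  is there for the least point, which has no left end a.\<close>

definition left_nbhd :: "'a option set \<Rightarrow> 'a option \<Rightarrow> bool" where
  "left_nbhd V p \<longleftrightarrow> (\<forall>x\<in>C. le x p \<longrightarrow> x \<in> V) \<or>
     (\<exists>a\<in>C. lt a p \<and> (\<forall>x\<in>C. lt a x \<and> le x p \<longrightarrow> x \<in> V))"

lemma left_nbhd_mono: "left_nbhd V p \<Longrightarrow> V \<subseteq> W \<Longrightarrow> left_nbhd W p"
  unfolding left_nbhd_def by blast

lemma left_nbhd_Int:
  assumes "left_nbhd V p" "left_nbhd W p"
  shows "left_nbhd (V \<inter> W) p"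
proof -
  consider "\<forall>x\<in>C. le x p \<longrightarrow> x \<in> V" | "\<forall>x\<in>C. le x p \<longrightarrow> x \<in> W"
    | a b where "a \<in> C" "lt a p" "\<forall>x\<in>C. lt a x \<and> le x p \<longrightarrow> x \<in> V"
        "b \<in> C" "lt b p" "\<forall>x\<in>C. lt b x \<and> le x p \<longrightarrow> x \<in> W"
    using assms unfolding left_nbhd_def by blast
  then show ?thesis
  proof cases
    case 3
    define c where "c = (if lt a b then b else a)"
    have "c \<in> C" "lt c p" using 3 by (auto simp: c_def)
    moreover have "le a c" "le b c" using 3 not_lt by (auto simp: c_def le_def)
    ultimately show ?thesis
      using 3 le_lt_trans unfolding left_nbhd_def by (metis IntI)
  qed (use assms in \<open>auto simp: left_nbhd_def\<close>)
qed

lemma left_nbhd_openin: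
  assumes "openin X V" "p \<in> V"
  shows "left_nbhd V p"
proof -
  have "generate_topology_on ({C} \<union> {{x \<in> C. lt x a} | a. a \<in> C} \<union> {{x \<in> C. lt a x} | a. a \<in> C}) V"
    using assms(1) unfolding ord_space_def by (simp add: openin_topology_generated_by_iff)
  then have "\<forall>p\<in>V. left_nbhd V p"
  proof induction
    case (Int V W)
    then show ?case using left_nbhd_Int by simp
  next
    case (UN K)
    then show ?case using left_nbhd_mono by (meson Sup_upper UnionE)
  next
    case (Basis S)
    then consider "S = C" | a where "a \<in> C" "S = {x \<in> C. lt x a}" | a where "a \<in> C" "S = {x \<in> C. lt a x}"
      by blast
    then show ?case
      by cases (auto simp: left_nbhd_def intro: le_lt_trans)
  qed simp
  then show ?thesis using assms by blast
qed

text \<open>Transfinite induction: an open set around m from the cover contains some interval (a,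
  m], and the segment up to a is finitely covered already. The top point \<open>None\<close> then
  gives the whole space.\<close>

lemma compact: "compact_space X"
  unfolding compact_space_alt
proof (intro allI impI, elim conjE)
  fix \<U> assume U: "\<forall>U\<in>\<U>. openin X U" "topspace X \<subseteq> \<Union>\<U>"
  define covered where "covered p \<longleftrightarrow> (\<exists>\<F>. finite \<F> \<and> \<F> \<subseteq> \<U> \<and> {x \<in> C. le x p} \<subseteq> \<Union>\<F>)" for p
  have "covered p" if "p \<in> C" for p
  proof (rule ccontr)
    assume "\<not> covered p"
    then have "{x \<in> C. \<not> covered x} \<noteq> {}" using that by blast
    then obtain m where "m \<in> {x \<in> C. \<not> covered x}"
      and least: "\<And>x. x \<in> {x \<in> C. \<not> covered x} \<Longrightarrow> le m x"
      using ex_least[of "{x \<in> C. \<not> covered x}"] by auto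
    then have m: "m \<in> C" "\<not> covered m" by auto
    obtain U' where U': "U' \<in> \<U>" "m \<in> U'" using U m topspace by blast
    then have "left_nbhd U' m" using U left_nbhd_openin by blast
    then consider "\<forall>x\<in>C. le x m \<longrightarrow> x \<in> U'"
      | a where "a \<in> C" "lt a m" "\<forall>x\<in>C. lt a x \<and> le x m \<longrightarrow> x \<in> U'"
      unfolding left_nbhd_def by blast
    then have "covered m"
    proof cases
      case 1
      then show ?thesis unfolding covered_def using U' by (intro exI[of _ "{U'}"]) auto
    next
      case 2
      then have "\<not> le m a" using lt_asym by (auto simp: le_def)
      then have "covered a" using least 2 by blast
      then obtain \<F> where F: "finite \<F>" "\<F> \<subseteq> \<U>" "{x \<in> C. le x a} \<subseteq> \<Union>\<F>"
        by (auto simp: covered_def)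
      have "x \<in> \<Union>(insert U' \<F>)" if "x \<in> C" "le x m" for x
        using F(3) 2(3) that not_lt[OF 2(1) that(1)] by auto
      then show ?thesis
        unfolding covered_def using U'(1) F(1,2) by (intro exI[of _ "insert U' \<F>"]) auto
    qed
    then show False using m by blast
  qed
  from this[OF None_mem] show "\<exists>\<F>. finite \<F> \<and> \<F> \<subseteq> \<U> \<and> topspace X \<subseteq> \<Union>\<F>"
    using le_None topspace by (simp add: covered_def)
qed

lemma Hausdorff: "Hausdorff_space X"
proof -
  have *: "\<exists>U V. openin X U \<and> openin X V \<and> x \<in> U \<and> y \<in> V \<and> disjnt U V"
    if "x \<in> C" "y \<in> C" "lt x y" for x y
    using that openin_le[of x] openin_greater[of x] lt_asym
    by (intro exI[of _ "{z \<in> C. le z x}"] exI[of _ "{z \<in> C. lt x z}"])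
      (auto simp: disjnt_iff le_def)
  show ?thesis
    unfolding Hausdorff_space_def topspace using * lt_total by (metis disjnt_sym)
qed

text \<open>Yields density of the isolated points, since every nonempty open set has a least element
  m. A left neighbourhood of m inside V contains nothing below m, so it reduces to {m}.\<close>

lemma least_isolated:
  assumes V: "openin X V" "m \<in> V" and least: "\<And>x. x \<in> V \<Longrightarrow> le m x"
  shows "m \<in> isolated_points X"
proof -
  have m: "m \<in> C" using V openin_subset topspace by blast
  have eq: "x = m" if "x \<in> V" "le x m" for x
    using least[OF that(1)] that(2) lt_asym by (auto simp: le_def)
  consider "\<forall>x\<in>C. le x m \<longrightarrow> x \<in> V"
    | a where "a \<in> C" "lt a m" "\<forall>x\<in>C. lt a x \<and> le x m \<longrightarrow> x \<in> V"
    using left_nbhd_openin[OF V] unfolding left_nbhd_def by blast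
  then show ?thesis
  proof cases
    case 1
    then have "{m} = {x \<in> C. le x m}" using eq m by auto
    then show ?thesis using openin_le[OF m] by (simp add: isolated_points_def)
  next
    case 2
    then have "{m} = {x \<in> C. lt a x} \<inter> {x \<in> C. le x m}" using eq m by auto
    then show ?thesis
      using openin_Int[OF openin_greater[OF 2(1)] openin_le[OF m]] by (simp add: isolated_points_def)
  qed
qed

lemma dense: "X closure_of isolated_points X = topspace X"
proof -
  have "\<exists>y. y \<in> isolated_points X \<and> y \<in> V" if V: "openin X V" "x \<in> V" for x V
  proof -
    obtain m where "m \<in> V" "\<And>x. x \<in> V \<Longrightarrow> le m x"
      using ex_least[of V] openin_subset[OF V(1)] V(2) topspace by blast
    then show ?thesis using least_isolated V by blast
  qed
  then show ?thesis by (auto simp: closure_of_def)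
qed

text \<open>Both sets are cofinal below x, so an increasing sequence can take its terms alternately
  from A and B. It converges to its supremum y, which lies strictly below x if x has uncountable
  cofinality.\<close>

lemma interleave:
  assumes A: "A \<subseteq> isolated_points X" and B: "B \<subseteq> isolated_points X"
    and x: "x \<in> X closure_of A" "x \<in> X closure_of B" and nx: "x \<notin> isolated_points X"
  shows "\<exists>S T y. S \<subseteq> A \<and> T \<subseteq> B \<and> infinite S \<and> infinite T \<and> converges_to X (S \<union> T) y"
proof -
  have xC: "x \<in> C" using x(1) by (simp add: in_closure_of topspace)
  have subC: "isolated_points X \<subseteq> C" using isolated_points_subset[of X] topspace by simp
  \<comment> \<open>A non-isolated x is not in E, so every left neighbourhood of x contains a point
    of E below x. If u is not a point below x, the last conjunct is vacuous; this covers the start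
    of the sequence.\<close>
  have near: "\<exists>a. a \<in> E \<and> lt a x \<and> (u \<in> C \<and> lt u x \<longrightarrow> lt u a)"
    if E: "E \<subseteq> isolated_points X" "x \<in> X closure_of E" for E u
  proof -
    define V where "V = {z \<in> C. le z x} \<inter> (if u \<in> C \<and> lt u x then {z \<in> C. lt u z} else C)"
    have "openin X V"
      unfolding V_def using openin_le[OF xC] openin_greater[of u] openin_topspace[of X]
      by (intro openin_Int) (simp_all add: topspace)
    moreover have "x \<in> V" using xC by (simp add: V_def)
    ultimately obtain a where "a \<in> E" "a \<in> V" using E(2) by (auto simp: in_closure_of)
    moreover have "a \<noteq> x" using \<open>a \<in> E\<close> E(1) nx by blast
    ultimately show ?thesis by (auto simp: V_def le_def split: if_splits)
  qed
  define E where "E n = (if even n then A else B)" for n :: nat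
  have E: "E n \<subseteq> isolated_points X" "x \<in> X closure_of E n" for n
    using A B x by (auto simp: E_def)
  have "\<exists>f. \<forall>n. (f n \<in> E n \<and> lt (f n) x) \<and> lt (f n) (f (Suc n))"
  proof (rule dependent_nat_choice)
    show "\<exists>a. a \<in> E 0 \<and> lt a x" using near[OF E] by blast
    show "\<exists>b. (b \<in> E (Suc n) \<and> lt b x) \<and> lt a b" if "a \<in> E n \<and> lt a x" for a n
    proof -
      have "a \<in> C" using that E(1)[of n] subC by blast
      then show ?thesis using near[OF E, of "Suc n" a] that by blast
    qed
  qed
  then obtain f where f: "\<And>n. f n \<in> E n" "\<And>n. lt (f n) x" "\<And>n. lt (f n) (f (Suc n))" by blast
  have fC: "f n \<in> C" for n using f(1) E(1) subC by blast
  have mono: "lt (f m) (f n)" if "m < n" for m n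
    using that
  proof (induction n)
    case (Suc n)
    then show ?case using f(3)[of n] lt_trans[of "f m" "f n"] by (auto simp: less_Suc_eq)
  qed simp
  have inj: "inj f" by (rule linorder_injI) (use mono in \<open>metis lt_irrefl\<close>)
  \<comment> \<open>The least upper bound of the sequence will be y. Any a below y is reached or
    exceeded by some \<open>f n\<close>, so all later terms lie in (a, y].\<close>
  define U where "U = {u \<in> C. \<forall>n. lt (f n) u}"
  have "x \<in> U" "U \<subseteq> C" using xC f(2) by (auto simp: U_def)
  then obtain y where "y \<in> U" and least: "\<And>u. u \<in> U \<Longrightarrow> le y u"
    using ex_least[of U] by auto
  then have y: "y \<in> C" "\<And>n. lt (f n) y" by (simp_all add: U_def)
  have "converges_to X (range f) y"
    unfolding converges_to_def
  proof (intro conjI allI impI)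
    show "y \<in> topspace X" using y topspace by simp
    fix V assume V: "openin X V \<and> y \<in> V"
    then have "left_nbhd V y" by (simp add: left_nbhd_openin)
    then consider "\<forall>z\<in>C. le z y \<longrightarrow> z \<in> V"
      | a where "a \<in> C" "lt a y" "\<forall>z\<in>C. lt a z \<and> le z y \<longrightarrow> z \<in> V"
      unfolding left_nbhd_def by blast
    then show "finite (range f - V)"
    proof cases
      case 1
      then have "range f - V = {}" using fC y(2) by (auto simp: le_def)
      then show ?thesis by (metis finite.emptyI)
    next
      case 2
      have "\<not> le y a" using 2(2) lt_asym by (auto simp: le_def)
      then obtain n where "\<not> lt (f n) a"
        using least[of a] 2(1) by (auto simp: U_def)
      then have "le a (f n)" using not_lt[OF fC 2(1)] by simp
      then have "f m \<in> V" if "n < m" for m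
        using 2(3) fC y(2) mono[OF that] le_lt_trans by (auto simp: le_def)
      then have "range f - V \<subseteq> f ` {..n}"
        by (auto simp: image_iff) (metis atMost_iff not_le)
      then show ?thesis by (rule finite_subset) simp
    qed
  qed
  moreover have "f ` {n. even n} \<union> f ` {n. odd n} = range f" by blast
  moreover have "infinite (f ` {n. even n})" "infinite (f ` {n. odd n})"
  proof -
    have "\<exists>n\<ge>m. even n" "\<exists>n\<ge>m. odd n" for m :: nat
      by (rule exI[of _ "2 * m"], simp) (rule exI[of _ "Suc (2 * m)"], simp)
    then have "infinite {n::nat. even n}" "infinite {n::nat. odd n}"
      by (simp_all add: infinite_nat_iff_unbounded_le)
    then show "infinite (f ` {n. even n})" "infinite (f ` {n. odd n})"
      using inj by (simp_all add: finite_image_iff inj_on_subset)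
  qed
  moreover have "f n \<in> A" if "even n" for n using f(1)[of n] that by (simp add: E_def)
  then have "f ` {n. even n} \<subseteq> A" by blast
  moreover have "f n \<in> B" if "odd n" for n using f(1)[of n] that by (simp add: E_def)
  then have "f ` {n. odd n} \<subseteq> B" by blast
  ultimately show ?thesis by metis
qed

lemma interleaved: "interleaved_space X"
proof (intro interleaved_space.intro)
  show "topspace X \<noteq> {}" using topspace None_mem by blast
qed (fact compact Hausdorff dense interleave)+

end

section \<open>Cantor--Bendixson rank\<close>

text \<open>A Cantor--Bendixson rank with values in the ordinals up to r. The last condition
  forces every smaller value to be attained near p, which determines such a function up to
  order isomorphism of the values.\<close>

definition cb_rank :: "'a topology \<Rightarrow> 'b rel \<Rightarrow> ('a \<Rightarrow> 'b option) \<Rightarrow> bool" where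
  "cb_rank X r \<rho> \<longleftrightarrow>
     (\<forall>p\<in>topspace X. \<rho> p \<in> ord_carrier r) \<and>
     (\<forall>p\<in>topspace X. \<exists>U. openin X U \<and> p \<in> U \<and> (\<forall>q\<in>U - {p}. ord_lt r (\<rho> q) (\<rho> p))) \<and>
     (\<forall>V. openin X V \<longrightarrow> (\<forall>p\<in>V. \<forall>w\<in>ord_carrier r. ord_lt r w (\<rho> p) \<longrightarrow> (\<exists>q\<in>V - {p}. \<rho> q = w)))"

lemma cb_rankD:
  assumes "cb_rank X r \<rho>"
  shows "p \<in> topspace X \<Longrightarrow> \<rho> p \<in> ord_carrier r"
    and "p \<in> topspace X \<Longrightarrow> \<exists>U. openin X U \<and> p \<in> U \<and> (\<forall>q\<in>U - {p}. ord_lt r (\<rho> q) (\<rho> p))"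
    and "\<lbrakk>openin X V; p \<in> V; w \<in> ord_carrier r; ord_lt r w (\<rho> p)\<rbrakk> \<Longrightarrow> \<exists>q\<in>V - {p}. \<rho> q = w"
  using assms unfolding cb_rank_def by blast+

lemma cb_rank_homeomorphic:
  assumes F: "homeomorphic_maps X Y F F'" and \<rho>: "cb_rank Y r \<rho>"
  shows "cb_rank X r (\<rho> \<circ> F)"
proof -
  have cF: "continuous_map X Y F" "continuous_map Y X F'"
    and inv: "\<And>x. x \<in> topspace X \<Longrightarrow> F' (F x) = x" "\<And>y. y \<in> topspace Y \<Longrightarrow> F (F' y) = y"
    using F by (auto simp: homeomorphic_maps_def)
  have mem: "\<And>x. x \<in> topspace X \<Longrightarrow> F x \<in> topspace Y" "\<And>y. y \<in> topspace Y \<Longrightarrow> F' y \<in> topspace X"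
    using cF by (auto dest: continuous_map_funspace)
  have nbhd: "\<exists>U. openin X U \<and> p \<in> U \<and> (\<forall>q\<in>U - {p}. ord_lt r (\<rho> (F q)) (\<rho> (F p)))"
    if p: "p \<in> topspace X" for p
  proof -
    obtain U where U: "openin Y U" "F p \<in> U" "\<forall>q\<in>U - {F p}. ord_lt r (\<rho> q) (\<rho> (F p))"
      using cb_rankD(2)[OF \<rho> mem(1)[OF p]] by blast
    have "openin X {x \<in> topspace X. F x \<in> U}"
      using openin_continuous_map_preimage[OF cF(1) U(1)] .
    moreover have "ord_lt r (\<rho> (F q)) (\<rho> (F p))" if "q \<in> {x \<in> topspace X. F x \<in> U} - {p}" for q
    proof -
      have "F q \<noteq> F p" using inv(1) p that by (metis Diff_iff mem_Collect_eq singletonI)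
      then show ?thesis using U(3) that by blast
    qed
    ultimately show ?thesis using U(2) p by (intro exI[of _ "{x \<in> topspace X. F x \<in> U}"]) blast
  qed
  have attained: "\<exists>q\<in>V - {p}. \<rho> (F q) = w"
    if V: "openin X V" "p \<in> V" and w: "w \<in> ord_carrier r" "ord_lt r w (\<rho> (F p))" for V p w
  proof -
    have p: "p \<in> topspace X" using V openin_subset by blast
    have "openin Y {y \<in> topspace Y. F' y \<in> V}"
      using openin_continuous_map_preimage[OF cF(2) V(1)] .
    moreover have "F p \<in> {y \<in> topspace Y. F' y \<in> V}" using mem inv(1) p V(2) by simp
    ultimately obtain q where q: "q \<in> {y \<in> topspace Y. F' y \<in> V} - {F p}" "\<rho> q = w"
      using cb_rankD(3)[OF \<rho> _ _ w] by blast
    then have "F' q \<in> V - {p}" "\<rho> (F (F' q)) = w" using inv(2) by auto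
    then show ?thesis by blast
  qed
  show ?thesis
    unfolding cb_rank_def comp_def using nbhd attained cb_rankD(1)[OF \<rho>] mem(1) by blast
qed

text \<open>A recursion for comparing ranks that involves the values only through comparisons at
  points p' near p. If q has smaller rank than p, the rank of q occurs at some p' near p but is not
  reached near q away from q itself. The bound W allows two rank functions to be treated on one
  neighbourhood.\<close>

lemma cb_rank_le_iff:
  assumes "Well_order r" "cb_rank X r \<rho>"
    and p: "p \<in> topspace X" and q: "q \<in> topspace X" and W: "openin X W" "p \<in> W"
  shows "well_order_space.le r (\<rho> p) (\<rho> q) \<longleftrightarrow>
    (\<exists>U. openin X U \<and> p \<in> U \<and> U \<subseteq> W \<and> (\<forall>p'\<in>U - {p}. \<forall>V. openin X V \<and> q \<in> V
       \<longrightarrow> (\<exists>q'\<in>V - {q}. well_order_space.le r (\<rho> p') (\<rho> q'))))"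
    (is "_ \<longleftrightarrow> ?R")
proof -
  interpret R: well_order_space r by (rule well_order_space.intro) fact
  note \<rho> = cb_rankD[OF assms(2)]
  show ?thesis
  proof
    assume le: "R.le (\<rho> p) (\<rho> q)"
    obtain U where U: "openin X U" "p \<in> U" "\<forall>p'\<in>U - {p}. R.lt (\<rho> p') (\<rho> p)"
      using \<rho>(2)[OF p] by blast
    have "\<exists>q'\<in>V - {q}. R.le (\<rho> p') (\<rho> q')"
      if p': "p' \<in> U \<inter> W - {p}" and V: "openin X V" "q \<in> V" for p' V
    proof -
      have "p' \<in> topspace X" using p' openin_subset[OF U(1)] by blast
      moreover have "R.lt (\<rho> p') (\<rho> q)" using p' U(3) le R.lt_le_trans by blast
      ultimately obtain q' where "q' \<in> V - {q}" "\<rho> q' = \<rho> p'"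
        using \<rho>(3)[OF V \<rho>(1)] by auto
      then show ?thesis by (metis R.le_refl)
    qed
    then show ?R using U(1,2) W by (intro exI[of _ "U \<inter> W"]) blast
  next
    assume ?R
    then obtain U where U: "openin X U" "p \<in> U"
      and U3: "\<forall>p'\<in>U - {p}. \<forall>V. openin X V \<and> q \<in> V \<longrightarrow> (\<exists>q'\<in>V - {q}. R.le (\<rho> p') (\<rho> q'))"
      by (elim exE conjE) (rule that)
    show "R.le (\<rho> p) (\<rho> q)"
    proof (rule ccontr)
      assume "\<not> R.le (\<rho> p) (\<rho> q)"
      then have "R.lt (\<rho> q) (\<rho> p)" using R.not_lt[OF \<rho>(1)[OF q] \<rho>(1)[OF p]] by auto
      then obtain p' where p': "p' \<in> U - {p}" "\<rho> p' = \<rho> q" using \<rho>(3)[OF U(1,2) \<rho>(1)[OF q]] by auto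
      obtain V where V: "openin X V" "q \<in> V" "\<forall>q'\<in>V - {q}. R.lt (\<rho> q') (\<rho> q)"
        using \<rho>(2)[OF q] by blast
      obtain q' where "q' \<in> V - {q}" "R.le (\<rho> p') (\<rho> q')" using U3[rule_format, OF p'(1) conjI[OF V(1,2)]] by auto
      then have "R.lt (\<rho> q') (\<rho> q)" "R.le (\<rho> q) (\<rho> q')" using V(3) p'(2) by auto
      then show False using R.le_lt_trans[of "\<rho> q" "\<rho> q'" "\<rho> q"] R.lt_irrefl by simp
    qed
  qed
qed

text \<open>Minimal counterexample with respect to the rank of the first point: the recursion of
  \<open>cb_rank_le_iff\<close> has the same form for both functions and, inside W, refers only to
  first points of smaller rank.\<close>

lemma cb_rank_compare:
  assumes r: "Well_order r" "cb_rank X r \<rho>" and r': "Well_order r'" "cb_rank X r' \<rho>'"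
    and "p \<in> topspace X" "q \<in> topspace X"
  shows "well_order_space.le r (\<rho> p) (\<rho> q) \<longleftrightarrow> well_order_space.le r' (\<rho>' p) (\<rho>' q)"
proof -
  interpret R: well_order_space r by (rule well_order_space.intro) fact
  interpret R': well_order_space r' by (rule well_order_space.intro) fact
  \<comment> \<open>The second point ranges over the whole space, since the recursion lowers only
    the rank of the first.\<close>
  define bad where "bad p \<longleftrightarrow> p \<in> topspace X \<and>
    (\<exists>q\<in>topspace X. R.le (\<rho> p) (\<rho> q) \<noteq> R'.le (\<rho>' p) (\<rho>' q))" for p
  have "\<not> bad p" for p
  proof
    assume "bad p"
    then have "\<rho> ` {p. bad p} \<noteq> {}" by blast
    moreover have "\<rho> ` {p. bad p} \<subseteq> R.C" using cb_rankD(1)[OF r(2)] by (auto simp: bad_def)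
    ultimately obtain m where "m \<in> \<rho> ` {p. bad p}" and m: "\<And>x. x \<in> \<rho> ` {p. bad p} \<Longrightarrow> R.le m x"
      using R.ex_least by metis
    then obtain s where s: "bad s" "m = \<rho> s" by blast
    then obtain t where t: "t \<in> topspace X" "R.le (\<rho> s) (\<rho> t) \<noteq> R'.le (\<rho>' s) (\<rho>' t)"
      by (auto simp: bad_def)
    have sX: "s \<in> topspace X" using s by (simp add: bad_def)
    obtain W where W: "openin X W" "s \<in> W" "\<forall>p'\<in>W - {s}. R.lt (\<rho> p') (\<rho> s)"
      using cb_rankD(2)[OF r(2) sX] by blast
    have eq: "R.le (\<rho> p') (\<rho> q') = R'.le (\<rho>' p') (\<rho>' q')"
      if p': "p' \<in> W - {s}" and q': "q' \<in> topspace X" for p' q'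
    proof -
      have "\<not> bad p'" 
      proof
        assume "bad p'"
        then have "R.le (\<rho> s) (\<rho> p')" using m s by blast
        then show False
          using W(3) p' R.le_lt_trans[of "\<rho> s" "\<rho> p'" "\<rho> s"] R.lt_irrefl by simp
      qed
      moreover have "p' \<in> topspace X" using p' openin_subset[OF W(1)] by blast
      ultimately show ?thesis using q' by (auto simp: bad_def)
    qed
    have "(\<exists>q'\<in>V - {t}. R.le (\<rho> p') (\<rho> q')) \<longleftrightarrow> (\<exists>q'\<in>V - {t}. R'.le (\<rho>' p') (\<rho>' q'))"
      if "p' \<in> W - {s}" "openin X V" for p' V
      using eq[OF that(1)] openin_subset[OF that(2)] by blast
    then have "R.le (\<rho> s) (\<rho> t) \<longleftrightarrow> R'.le (\<rho>' s) (\<rho>' t)"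
      unfolding cb_rank_le_iff[OF r sX t(1) W(1,2)] cb_rank_le_iff[OF r' sX t(1) W(1,2)]
      by (intro ex_cong1 conj_cong refl ball_cong all_cong) blast+
    then show False using t(2) by blast
  qed
  then show ?thesis using assms(5,6) by (auto simp: bad_def)
qed

lemma cb_rank_surj:
  assumes \<rho>: "cb_rank X r \<rho>" and p: "p \<in> topspace X" "\<rho> p = None" and w: "w \<in> ord_carrier r"
  obtains q where "q \<in> topspace X" "\<rho> q = w"
proof (cases w)
  case None
  then show ?thesis using that p by blast
next
  case (Some a)
  then have "ord_lt r w (\<rho> p)" using p by (simp add: ord_lt_def)
  then show ?thesis using that cb_rankD(3)[OF \<rho> openin_topspace p(1) w] by blast
qed

text \<open>Both functions induce the same preorder on the points. Since the top value is attained,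
  so is every smaller one, and the ordered set of values is the quotient of this preorder; removing
  its top class leaves r and r' respectively.\<close>

lemma cb_rank_ordIso:
  assumes r: "Well_order r" "cb_rank X r \<rho>" and r': "Well_order r'" "cb_rank X r' \<rho>'"
    and top: "p \<in> topspace X" "\<rho> p = None" "p' \<in> topspace X" "\<rho>' p' = None"
  shows "(r, r') \<in> ordIso" and "q \<in> topspace X \<Longrightarrow> \<rho> q = None \<longleftrightarrow> \<rho>' q = None"
proof -
  interpret R: well_order_space r by (rule well_order_space.intro) fact
  interpret R': well_order_space r' by (rule well_order_space.intro) fact
  note cmp = cb_rank_compare[OF r r']
  have eq_iff: "\<rho> x = \<rho> y \<longleftrightarrow> \<rho>' x = \<rho>' y" if "x \<in> topspace X" "y \<in> topspace X" for x y
  proof -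
    have "\<rho> x = \<rho> y \<longleftrightarrow> R.le (\<rho> x) (\<rho> y) \<and> R.le (\<rho> y) (\<rho> x)"
      using R.lt_asym by (auto simp: R.le_def)
    moreover have "\<rho>' x = \<rho>' y \<longleftrightarrow> R'.le (\<rho>' x) (\<rho>' y) \<and> R'.le (\<rho>' y) (\<rho>' x)"
      using R'.lt_asym by (auto simp: R'.le_def)
    ultimately show ?thesis using cmp that by simp
  qed
  have top_iff: "\<rho> q = None \<longleftrightarrow> \<rho>' q = None" if q: "q \<in> topspace X" for q
  proof -
    have "\<rho> q = None \<longleftrightarrow> R.le None (\<rho> q)" by (cases "\<rho> q") (auto simp: R.le_def ord_lt_def)
    also have "\<dots> \<longleftrightarrow> R'.le (\<rho>' p) (\<rho>' q)" using cmp[OF top(1) q] top by simp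
    also have "\<rho>' p = None"
    proof -
      have "R.le (\<rho> p') (\<rho> p)" using R.le_None top by simp
      then have "R'.le None (\<rho>' p)" using cmp[OF top(3,1)] top by simp
      then show ?thesis by (cases "\<rho>' p") (auto simp: R'.le_def ord_lt_def)
    qed
    also have "R'.le None (\<rho>' q) \<longleftrightarrow> \<rho>' q = None"
      by (cases "\<rho>' q") (auto simp: R'.le_def ord_lt_def)
    finally show ?thesis .
  qed
  then show "q \<in> topspace X \<Longrightarrow> \<rho> q = None \<longleftrightarrow> \<rho>' q = None" by blast
  \<comment> \<open>A representative of each rank; the choice does not affect \<open>f\<close>,
    because the two rank functions have the same level sets.\<close>
  define P where "P w = (SOME q. q \<in> topspace X \<and> \<rho> q = w)" for w
  have P: "P w \<in> topspace X" "\<rho> (P w) = w" if "w \<in> R.C" for w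
  proof -
    have "\<exists>q. q \<in> topspace X \<and> \<rho> q = w" using cb_rank_surj[OF r(2) top(1,2) that] by metis
    then have "P w \<in> topspace X \<and> \<rho> (P w) = w" unfolding P_def by (rule someI_ex)
    then show "P w \<in> topspace X" "\<rho> (P w) = w" by auto
  qed
  define f where "f a = the (\<rho>' (P (Some a)))" for a
  have fS: "Some (f a) = \<rho>' (P (Some a))" if "a \<in> Field r" for a
  proof -
    have "Some a \<in> R.C" using that by (simp add: ord_carrier_def)
    then have "\<rho>' (P (Some a)) \<noteq> None" using top_iff P by (metis option.distinct(1))
    then show ?thesis by (simp add: f_def)
  qed
  have le_r: "(a, b) \<in> r \<longleftrightarrow> R.le (Some a) (Some b)" if "a \<in> Field r" "b \<in> Field r" for a b
    using that r(1) by (auto simp: R.le_def ord_lt_def order_on_defs refl_on_def)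
  have le_r': "(a, b) \<in> r' \<longleftrightarrow> R'.le (Some a) (Some b)" if "a \<in> Field r'" "b \<in> Field r'" for a b
    using that r'(1) by (auto simp: R'.le_def ord_lt_def order_on_defs refl_on_def)
  have C: "Some a \<in> R.C" if "a \<in> Field r" for a using that by (simp add: ord_carrier_def)
  have fF: "f a \<in> Field r'" if "a \<in> Field r" for a
  proof -
    have "Some (f a) \<in> R'.C" using fS[OF that] cb_rankD(1)[OF r'(2) P(1)[OF C[OF that]]] by simp
    then show ?thesis by (auto simp: ord_carrier_def)
  qed
  have ord: "(a, b) \<in> r \<longleftrightarrow> (f a, f b) \<in> r'" if "a \<in> Field r" "b \<in> Field r" for a b
    using cmp[OF P(1)[OF C[OF that(1)]] P(1)[OF C[OF that(2)]]] P(2) C that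
    by (simp add: le_r le_r' fF fS)
  have "inj_on f (Field r)"
  proof (rule inj_onI)
    fix a b assume ab: "a \<in> Field r" "b \<in> Field r" "f a = f b"
    then have "\<rho>' (P (Some a)) = \<rho>' (P (Some b))" using fS by metis
    then show "a = b" using eq_iff P C ab by (metis option.inject)
  qed
  moreover have "b \<in> f ` Field r" if b: "b \<in> Field r'" for b
  proof -
    have "Some b \<in> R'.C" using b by (simp add: ord_carrier_def)
    then obtain q where q: "q \<in> topspace X" "\<rho>' q = Some b"
      using cb_rank_surj[OF r'(2) top(3,4)] by metis
    then have "\<rho> q \<noteq> None" using top_iff by simp
    then obtain a where a: "\<rho> q = Some a" by blast
    then have aF: "a \<in> Field r" using cb_rankD(1)[OF r(2) q(1)] by (auto simp: ord_carrier_def)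
    have "\<rho>' (P (Some a)) = \<rho>' q" using eq_iff[of "P (Some a)" q] P C[OF aF] a q by simp
    then have "f a = b" using fS[OF aF] q by simp
    then show ?thesis using aF by blast
  qed
  ultimately have "bij_betw f (Field r) (Field r')" using fF by (auto simp: bij_betw_def)
  then have "iso r r' f" using ord by (simp add: iso_iff2)
  then show "(r, r') \<in> ordIso" using r(1) r'(1) unfolding ordIso_def by blast
qed

section \<open>The rank function on the ordinal space of omega^\<alpha> * k\<close>

locale omega_power =
  fixes \<alpha> :: "'a rel" and k :: nat
  assumes well_order_exp: "Well_order \<alpha>" and k: "k \<ge> 1"
begin

sublocale E: well_order_space \<alpha>
  by (rule well_order_space.intro) (rule well_order_exp)

abbreviation below :: "'a \<Rightarrow> 'a \<Rightarrow> bool" where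
  "below x y \<equiv> (x, y) \<in> \<alpha> \<and> x \<noteq> y"

lemma below_trans: "below x y \<Longrightarrow> below y z \<Longrightarrow> below x z"
  and below_asym: "below x y \<Longrightarrow> \<not> below y x"
  and below_total: "x \<in> Field \<alpha> \<Longrightarrow> y \<in> Field \<alpha> \<Longrightarrow> x = y \<or> below x y \<or> below y x"
  using E.lt_trans[of "Some x" "Some y" "Some z"] E.lt_asym[of "Some x" "Some y"]
    E.lt_total[of "Some x" "Some y"]
  by (auto simp: ord_lt_def ord_carrier_def)

text \<open>Cantor normal forms below omega^\<alpha>, with f x the coefficient of omega^x. A pair
  (i, f) stands for the ordinal omega^\<alpha> * i + f.\<close>

definition exponents :: "('a \<Rightarrow> nat) set" where
  "exponents = {f. (\<forall>x. x \<notin> Field \<alpha> \<longrightarrow> f x = 0) \<and> finite {x. f x \<noteq> 0}}"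

definition lex :: "('a \<Rightarrow> nat) \<Rightarrow> ('a \<Rightarrow> nat) \<Rightarrow> bool" where
  "lex f g \<longleftrightarrow> (\<exists>x\<in>Field \<alpha>. f x < g x \<and> (\<forall>y. below x y \<longrightarrow> f y = g y))"

lemma exponentsD: "f \<in> exponents \<Longrightarrow> f x \<noteq> 0 \<Longrightarrow> x \<in> Field \<alpha>"
  by (auto simp: exponents_def)

lemma lex_irrefl [simp]: "\<not> lex f f"
  by (simp add: lex_def)

lemma lex_zero [simp]: "\<not> lex f (\<lambda>_. 0)"
  by (simp add: lex_def)

lemma lex_trans:
  assumes "lex f g" "lex g h"
  shows "lex f h"
proof -
  obtain x where x: "x \<in> Field \<alpha>" "f x < g x" "\<And>z. below x z \<Longrightarrow> f z = g z"
    using assms(1) unfolding lex_def by auto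
  obtain y where y: "y \<in> Field \<alpha>" "g y < h y" "\<And>z. below y z \<Longrightarrow> g z = h z"
    using assms(2) unfolding lex_def by auto
  consider "x = y" | "below x y" | "below y x" using below_total[OF x(1) y(1)] by auto
  then show ?thesis
  proof cases
    case 1
    then show ?thesis unfolding lex_def using x y by (intro bexI[of _ x]) auto
  next
    case 2
    then show ?thesis
      unfolding lex_def using x(3) y below_trans[OF 2] by (intro bexI[of _ y]) auto
  next
    case 3
    then show ?thesis
      unfolding lex_def using x y(3) below_trans[OF 3] by (intro bexI[of _ x]) auto
  qed
qed

lemma lex_total:
  assumes f: "f \<in> exponents" and g: "g \<in> exponents" and "f \<noteq> g"
  shows "lex f g \<or> lex g f"
proof -
  define A where "A = {x. f x \<noteq> g x}"
  have sub: "A \<subseteq> Field \<alpha>" using f g by (force simp: A_def exponents_def)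
  have "A \<subseteq> {x. f x \<noteq> 0} \<union> {x. g x \<noteq> 0}" by (auto simp: A_def)
  then have "finite A" using f g by (simp add: exponents_def finite_subset)
  moreover have "A \<noteq> {}" using \<open>f \<noteq> g\<close> by (auto simp: A_def)
  moreover have "asymp_on A below" using below_asym by (auto intro!: asymp_onI)
  moreover have "transp_on A below" using below_trans by (intro transp_onI) blast
  ultimately obtain m where m: "m \<in> A" "\<forall>x\<in>A. x \<noteq> m \<longrightarrow> \<not> below m x"
    using Finite_Set.bex_max_element[of A below] by blast
  have "f y = g y" if "below m y" for y
    using m(2) that by (auto simp: A_def)
  moreover have "m \<in> Field \<alpha>" "f m < g m \<or> g m < f m" using m(1) sub by (auto simp: A_def)
  ultimately show ?thesis unfolding lex_def by metis
qed

text \<open>Coefficient functions are multisets of exponents, and comparing them at the largest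
  difference is a case of the multiset order, which is well-founded.\<close>

lemma lex_mult:
  assumes f: "f \<in> exponents" and g: "g \<in> exponents" and "lex f g"
  shows "(Abs_multiset f, Abs_multiset g) \<in> mult (\<alpha> - Id)"
proof -
  obtain x where x: "x \<in> Field \<alpha>" "f x < g x" "\<And>y. below x y \<Longrightarrow> f y = g y"
    using assms(3) unfolding lex_def by auto
  define M N where "M = Abs_multiset f" and "N = Abs_multiset g"
  have cM: "count M = f" and cN: "count N = g"
    using f g by (simp_all add: M_def N_def exponents_def)
  have eq: "M = M \<inter># N + (M - N)" "N = M \<inter># N + (N - M)"
    by (auto intro!: multiset_eqI)
  have "\<exists>j\<in>#N - M. (z, j) \<in> \<alpha> - Id" if z: "z \<in># M - N" for z
  proof -
    have gz: "g z < f z" using z cM cN by (simp add: in_diff_count)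
    then have "z \<in> Field \<alpha>" using exponentsD[OF f, of z] by simp
    moreover have "z \<noteq> x" "\<not> below x z" using gz x(2) x(3)[of z] by auto
    ultimately have "below z x" using below_total x(1) by blast
    moreover have "x \<in># N - M" using x(2) cM cN by (simp add: in_diff_count)
    ultimately show ?thesis by blast
  qed
  moreover have "N - M \<noteq> {#}"
  proof -
    have "x \<in># N - M" using x(2) cM cN by (simp add: in_diff_count)
    then show ?thesis by auto
  qed
  ultimately have "(M \<inter># N + (M - N), M \<inter># N + (N - M)) \<in> mult (\<alpha> - Id)"
    by (intro one_step_implies_mult) auto
  then show ?thesis using eq by (simp flip: M_def N_def)
qed

abbreviation "R \<equiv> omega_pow_mult \<alpha> k"

lemma oexp_carrier_iff: "(i, f) \<in> oexp_carrier \<alpha> k \<longleftrightarrow> i < k \<and> f \<in> exponents"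
  by (simp add: oexp_carrier_def exponents_def)

lemma R_iff: "((i, f), (j, g)) \<in> R \<longleftrightarrow> i < k \<and> j < k \<and> f \<in> exponents \<and> g \<in> exponents
    \<and> (i < j \<or> i = j \<and> (f = g \<or> lex f g))"
proof -
  have "(\<exists>x\<in>Field \<alpha>. f x < g x \<and> (\<forall>y\<in>Field \<alpha>. (x, y) \<in> \<alpha> \<and> y \<noteq> x \<longrightarrow> f y = g y)) \<longleftrightarrow> lex f g"
    unfolding lex_def by (intro bex_cong refl conj_cong) (auto simp: Field_def)
  then show ?thesis unfolding omega_pow_mult_def by (auto simp: oexp_carrier_iff)
qed

lemma Field_R: "Field R = {..<k} \<times> exponents"
proof -
  have "(p, p) \<in> R" if "p \<in> {..<k} \<times> exponents" for p using that by (auto simp: R_iff)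
  moreover have "p \<in> {..<k} \<times> exponents" "q \<in> {..<k} \<times> exponents" if "(p, q) \<in> R" for p q
    using that by (cases p; cases q; auto simp: R_iff)+
  ultimately show ?thesis by (fastforce simp: Field_def)
qed

lemma well_order_R: "Well_order R"
proof -
  have refl: "refl_on (Field R) R"
    by (rule refl_onI) (auto simp: Field_R R_iff Field_def)
  have sub: "R \<subseteq> Field R \<times> Field R" by (auto simp: Field_def)
  have trans: "trans R"
  proof (rule transI)
    fix p q s assume "(p, q) \<in> R" "(q, s) \<in> R"
    then show "(p, s) \<in> R"
      by (cases p; cases q; cases s) (auto simp: R_iff intro: lex_trans)
  qed
  have antisym: "antisym R"
  proof (rule antisymI)
    fix p q assume "(p, q) \<in> R" "(q, p) \<in> R"
    then show "p = q" by (cases p; cases q) (auto simp: R_iff dest: lex_trans)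
  qed
  have total: "total_on (Field R) R"
  proof (rule total_onI)
    fix p q assume "p \<in> Field R" "q \<in> Field R" "p \<noteq> q"
    then show "(p, q) \<in> R \<or> (q, p) \<in> R"
      using lex_total by (cases p; cases q) (auto simp: R_iff Field_R)
  qed
  have "wf (R - Id)"
  proof (rule wf_subset)
    have "wf (\<alpha> - Id)" using well_order_exp by (simp add: well_order_on_def)
    then show "wf (inv_image (less_than <*lex*> mult (\<alpha> - Id)) (\<lambda>(i, f). (i, Abs_multiset f)))"
      by (intro wf_inv_image wf_lex_prod wf_less_than wf_mult)
    show "R - Id \<subseteq> inv_image (less_than <*lex*> mult (\<alpha> - Id)) (\<lambda>(i, f). (i, Abs_multiset f))"
      using lex_mult by (auto simp: R_iff inv_image_def)
  qed
  then show ?thesis using refl sub trans antisym total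
    by (simp add: order_on_defs)
qed

sublocale X: well_order_space R
  by (rule well_order_space.intro) (rule well_order_R)

lemma X_carrier: "X.C = insert None (Some ` ({..<k} \<times> exponents))"
  by (auto simp: ord_carrier_def Field_R)

lemma Some_carrier: "Some (i, f) \<in> X.C \<longleftrightarrow> i < k \<and> f \<in> exponents"
  by (auto simp: X_carrier)

lemma lt_Some: "X.lt (Some (i, f)) (Some (j, g)) \<longleftrightarrow>
    i < k \<and> j < k \<and> f \<in> exponents \<and> g \<in> exponents \<and> (i < j \<or> i = j \<and> lex f g)"
  by (auto simp: ord_lt_def R_iff)

lemma lt_None: "X.lt (Some p) None" "\<not> X.lt None q"
  by (auto simp: ord_lt_def)

abbreviation zero :: "'a \<Rightarrow> nat" where "zero \<equiv> (\<lambda>_. 0)"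

lemma zero_exponents [simp]: "zero \<in> exponents"
  by (simp add: exponents_def)

text \<open>Despite the name this is the least exponent occurring in the normal form, not the
  greatest.\<close>

definition is_lead :: "('a \<Rightarrow> nat) \<Rightarrow> 'a \<Rightarrow> bool" where
  "is_lead f x \<longleftrightarrow> f x \<noteq> 0 \<and> (\<forall>y. below y x \<longrightarrow> f y = 0)"

text \<open>On the zero function the value is arbitrary; \<open>point_rank\<close> treats that case
  separately.\<close>

definition lead :: "('a \<Rightarrow> nat) \<Rightarrow> 'a" where
  "lead f = (SOME x. is_lead f x)"

lemma is_lead_unique:
  assumes "f \<in> exponents" "is_lead f x" "is_lead f y"
  shows "x = y"
  using assms below_total[of x y] exponentsD[OF assms(1)] by (auto simp: is_lead_def)

lemma is_lead_lead:
  assumes f: "f \<in> exponents" and z: "f z \<noteq> 0"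
  shows "is_lead f (lead f)" "z = lead f \<or> below (lead f) z"
proof -
  have sub: "Some ` {x. f x \<noteq> 0} \<subseteq> E.C"
    using exponentsD[OF f] by (auto simp: ord_carrier_def)
  obtain m where "m \<in> Some ` {x. f x \<noteq> 0}"
    and least: "\<And>x. x \<in> Some ` {x. f x \<noteq> 0} \<Longrightarrow> E.le m x"
    using E.ex_least[OF sub] z by auto
  then obtain x where x: "m = Some x" "f x \<noteq> 0" by auto
  have x_le: "y = x \<or> below x y" if "f y \<noteq> 0" for y
    using least[of "Some y"] that x(1) by (auto simp: E.le_def ord_lt_def)
  have "f y = 0" if "below y x" for y
    using x_le[of y] that below_asym[OF that] by auto
  then have "is_lead f x" using x(2) by (simp add: is_lead_def)
  then show *: "is_lead f (lead f)" unfolding lead_def by (rule someI)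
  have "lead f = x" using is_lead_unique[OF f * \<open>is_lead f x\<close>] .
  then show "z = lead f \<or> below (lead f) z" using x_le z by simp
qed

lemma lead_eqI: "f \<in> exponents \<Longrightarrow> is_lead f x \<Longrightarrow> lead f = x"
  using is_lead_unique is_lead_lead(1) by (metis is_lead_def)

lemma lead_Field: "f \<in> exponents \<Longrightarrow> f \<noteq> zero \<Longrightarrow> lead f \<in> Field \<alpha>"
  using is_lead_lead(1) exponentsD by (metis ext is_lead_def)

text \<open>The rank 0, needed for the ordinal 0, whose normal form is empty. For \<alpha> = 0 it
  coincides with the top value \<open>None\<close>, the only value there is.\<close>

definition bottom :: "'a option" where
  "bottom = (SOME m. m \<in> E.C \<and> (\<forall>x\<in>E.C. E.le m x))"

lemma bottom: "bottom \<in> E.C" "x \<in> E.C \<Longrightarrow> E.le bottom x"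
proof -
  have "E.C \<noteq> {}" using E.None_mem by blast
  then obtain m where "m \<in> E.C" "\<And>x. x \<in> E.C \<Longrightarrow> E.le m x"
    using E.ex_least[OF subset_refl] by metis
  then have "\<exists>m. m \<in> E.C \<and> (\<forall>x\<in>E.C. E.le m x)" by blast
  then have "bottom \<in> E.C \<and> (\<forall>x\<in>E.C. E.le bottom x)" unfolding bottom_def by (rule someI_ex)
  then show "bottom \<in> E.C" "x \<in> E.C \<Longrightarrow> E.le bottom x" by auto
qed

lemma bottom_None: "bottom = None \<longleftrightarrow> Field \<alpha> = {}"
proof
  assume "bottom = None"
  then have "\<not> Some x \<in> E.C" for x using bottom(2)[of "Some x"] by (auto simp: E.le_def ord_lt_def)
  then show "Field \<alpha> = {}" by (auto simp: ord_carrier_def)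
next
  assume "Field \<alpha> = {}"
  then show "bottom = None" using bottom(1) by (simp add: ord_carrier_def)
qed

text \<open>An ordinal in Cantor normal form has its least exponent as rank. Here None stands for
  the rank \<alpha> itself, which is also that of the nonzero multiples of omega to the power \<alpha>.\<close>

fun point_rank :: "(nat \<times> ('a \<Rightarrow> nat)) option \<Rightarrow> 'a option" where
  "point_rank None = None"
| "point_rank (Some (i, f)) = (if f \<noteq> zero then Some (lead f) else if i = 0 then bottom else None)"

lemma rank_carrier:
  assumes "p \<in> X.C"
  shows "point_rank p \<in> E.C"
proof (cases p)
  case (Some q)
  then obtain i f where q: "p = Some (i, f)" by (cases q) auto
  then have "f \<in> exponents" using assms Some_carrier by simp
  then show ?thesis using q lead_Field bottom(1) E.None_mem by (auto simp: ord_carrier_def)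
qed (use E.None_mem in simp)

lemma lex_from_zero: "lex zero g \<Longrightarrow> g \<noteq> zero"
  by (auto simp: lex_def)

text \<open>The lower bound is f with one copy of its last term omega^(lead f) removed. Hence g is
  this bound plus a nonzero remainder below omega^(lead f), and the least exponent of g is that of
  the remainder.\<close>

lemma between_pred:
  assumes f: "f \<in> exponents" "f \<noteq> zero" and g: "g \<in> exponents"
    and lo: "lex (f(lead f := f (lead f) - 1)) g" and hi: "lex g f"
  shows "g \<noteq> zero" "below (lead g) (lead f)"
proof -
  define x where "x = lead f"
  define f' where "f' = f(x := f x - 1)"
  have "is_lead f x" using is_lead_lead(1)[OF f(1)] f(2) by (auto simp: x_def)
  then have fx: "f x \<noteq> 0" and zero_below: "\<And>y. below y x \<Longrightarrow> f y = 0"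
    by (auto simp: is_lead_def)
  have xF: "x \<in> Field \<alpha>" using exponentsD[OF f(1) fx] .
  obtain e where e: "e \<in> Field \<alpha>" "f' e < g e" "\<And>y. below e y \<Longrightarrow> f' y = g y"
    using lo unfolding lex_def f'_def x_def by auto
  obtain d where d: "d \<in> Field \<alpha>" "g d < f d" "\<And>y. below d y \<Longrightarrow> g y = f y"
    using hi unfolding lex_def by auto
  have f'_eq: "f' y = f y" if "y \<noteq> x" for y using that by (simp add: f'_def)
  \<comment> \<open>If the largest difference between f' and g were at x, then g x \<ge> f x, and f
    has no terms below x, so g could not be less than f; if it were above x, then g would exceed
    f.\<close>
  have "below e x"
  proof -
    consider "e = x" | "below x e" | "below e x" using below_total[OF e(1) xF] by auto
    then show ?thesis
    proof cases
      case 1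
      then have "g x \<ge> f x" using e(2) by (simp add: f'_def)
      then have "d \<noteq> x" using d(2) by auto
      moreover have "\<not> below x d" using e(3)[of d] 1 f'_eq[OF \<open>d \<noteq> x\<close>] d(2) by auto
      ultimately have "below d x" using below_total[OF d(1) xF] by blast
      then show ?thesis using zero_below d(2) by simp
    next
      case 2
      then have fe: "f e < g e" using e(2) f'_eq by auto
      then have "d \<noteq> e" using d(2) by auto
      moreover have "\<not> below d e" using d(3)[of e] fe by auto
      ultimately have de: "below e d" using below_total[OF d(1) e(1)] by blast
      then have "d \<noteq> x" using 2 below_asym by blast
      then show ?thesis using e(3)[OF de] f'_eq d(2) by simp
    qed
  qed
  have ge: "g e \<noteq> 0" using e(2) by simp
  then show "g \<noteq> zero" by auto
  have "e = lead g \<or> below (lead g) e" using is_lead_lead(2)[OF g ge] .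
  then show "below (lead g) (lead f)"
    using \<open>below e x\<close> below_trans[of "lead g" e x] unfolding x_def by auto
qed

lemma exponents_mono:
  assumes "f \<in> exponents" "\<And>y. g y \<noteq> 0 \<Longrightarrow> f y \<noteq> 0"
  shows "g \<in> exponents"
proof -
  have "finite {y. g y \<noteq> 0}"
    by (rule finite_subset[of _ "{y. f y \<noteq> 0}"]) (use assms in \<open>auto simp: exponents_def\<close>)
  moreover have "g x = 0" if "x \<notin> Field \<alpha>" for x
    using assms that unfolding exponents_def by blast
  ultimately show ?thesis by (simp add: exponents_def)
qed

text \<open>Each nonzero p is a plus omega to the power of its rank, where a is p with one copy of
  its last term dropped; the other points of (a, p] are a plus a smaller nonzero remainder. For the
  top point a is omega^\<alpha> * (k - 1), and for omega^\<alpha> * i it is omega^\<alpha> * (i -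
  1). The ordinal 0 has no such a and is isolated as the least point.\<close>

lemma rank_nbhd:
  assumes p: "p \<in> X.C"
  shows "\<exists>U. openin X.X U \<and> p \<in> U \<and> (\<forall>q\<in>U - {p}. E.lt (point_rank q) (point_rank p))"
proof -
  have left: ?thesis
    if a: "a \<in> X.C" "X.lt a p" and small: "\<And>q. q \<in> X.C \<Longrightarrow> X.lt a q \<Longrightarrow> X.lt q p \<Longrightarrow> E.lt (point_rank q) (point_rank p)"
    for a
  proof (intro exI conjI ballI)
    show "openin X.X ({z \<in> X.C. X.lt a z} \<inter> {z \<in> X.C. X.le z p})"
      using X.openin_greater[OF a(1)] X.openin_le[OF p] by (rule openin_Int)
    show "p \<in> {z \<in> X.C. X.lt a z} \<inter> {z \<in> X.C. X.le z p}" using p a by simp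
    fix q assume "q \<in> {z \<in> X.C. X.lt a z} \<inter> {z \<in> X.C. X.le z p} - {p}"
    then show "E.lt (point_rank q) (point_rank p)" using small by (auto simp: X.le_def)
  qed
  show ?thesis
  proof (cases p)
    case None
    show ?thesis
    proof (rule left[of "Some (k - 1, zero)"])
      show "Some (k - 1, zero) \<in> X.C" using k by (simp add: Some_carrier)
      show "X.lt (Some (k - 1, zero)) p" using None lt_None by simp
      fix q assume q: "q \<in> X.C" "X.lt (Some (k - 1, zero)) q" "X.lt q p"
      then obtain j g where jg: "q = Some (j, g)" using None by (cases q) auto
      then have "lex zero g" using q by (auto simp: lt_Some)
      then show "E.lt (point_rank q) (point_rank p)"
        using None jg lex_from_zero by (simp add: ord_lt_def)
    qed
  next
    case (Some p')
    then obtain i f where pi: "p = Some (i, f)" by (cases p') auto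
    then have f: "f \<in> exponents" "i < k" using p by (auto simp: Some_carrier)
    consider "f = zero" "i = 0" | "f = zero" "i > 0" | "f \<noteq> zero" by blast
    then show ?thesis
    proof cases
      case 1
      show ?thesis
      proof (intro exI conjI ballI)
        show "openin X.X {z \<in> X.C. X.le z p}" using X.openin_le[OF p] .
        show "p \<in> {z \<in> X.C. X.le z p}" using p by simp
        fix q assume "q \<in> {z \<in> X.C. X.le z p} - {p}"
        then have "X.lt q p" by (auto simp: X.le_def)
        then show "E.lt (point_rank q) (point_rank p)"
          using 1 pi by (cases q) (auto simp: lt_Some lt_None)
      qed
    next
      case 2
      show ?thesis
      proof (rule left[of "Some (i - 1, zero)"])
        show "Some (i - 1, zero) \<in> X.C" using f by (simp add: Some_carrier)
        show "X.lt (Some (i - 1, zero)) p" using 2 f pi by (simp add: lt_Some)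
        fix q assume q: "q \<in> X.C" "X.lt (Some (i - 1, zero)) q" "X.lt q p"
        then obtain j g where jg: "q = Some (j, g)" using lt_None by (cases q) auto
        then have "j = i - 1" "lex zero g" using q 2 pi by (auto simp: lt_Some)
        then show "E.lt (point_rank q) (point_rank p)"
          using 2 pi jg lex_from_zero by (auto simp: ord_lt_def)
      qed
    next
      case 3
      let ?f' = "f(lead f := f (lead f) - 1)"
      have lf: "is_lead f (lead f)" using is_lead_lead(1)[OF f(1)] 3 by auto
      then have lf0: "f (lead f) \<noteq> 0" by (simp add: is_lead_def)
      have f': "?f' \<in> exponents" by (rule exponents_mono[OF f(1)]) (auto split: if_splits)
      show ?thesis
      proof (rule left[of "Some (i, ?f')"])
        show "Some (i, ?f') \<in> X.C" using f f' by (simp add: Some_carrier)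
        have "lex ?f' f"
          unfolding lex_def using lf0 lead_Field[OF f(1) 3] by (intro bexI[of _ "lead f"]) auto
        then show "X.lt (Some (i, ?f')) p" using f f' pi by (simp add: lt_Some)
        fix q assume q: "q \<in> X.C" "X.lt (Some (i, ?f')) q" "X.lt q p"
        then obtain j g where jg: "q = Some (j, g)" using lt_None by (cases q) auto
        then have "j = i" "lex ?f' g" "lex g f" "g \<in> exponents" using q pi by (auto simp: lt_Some)
        then show "E.lt (point_rank q) (point_rank p)"
          using between_pred[OF f(1) 3, of g] 3 pi jg by (simp add: ord_lt_def)
      qed
    qed
  qed
qed

text \<open>The ordinal sum g + omega^w: terms with exponent below w are absorbed, and the
  coefficient at w increases by one.\<close>

definition bump :: "'a \<Rightarrow> ('a \<Rightarrow> nat) \<Rightarrow> 'a \<Rightarrow> nat" where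
  "bump w g y = (if below y w then 0 else if y = w then Suc (g w) else g y)"

lemma bump:
  assumes g: "g \<in> exponents" and w: "w \<in> Field \<alpha>"
  shows "bump w g \<in> exponents" "bump w g \<noteq> zero" "lead (bump w g) = w" "lex g (bump w g)"
proof -
  have "{y. bump w g y \<noteq> 0} \<subseteq> insert w {y. g y \<noteq> 0}" by (auto simp: bump_def)
  then have "finite {y. bump w g y \<noteq> 0}" using g finite_subset by (fastforce simp: exponents_def)
  then show e: "bump w g \<in> exponents" using g w by (auto simp: exponents_def bump_def)
  have w0: "bump w g w \<noteq> 0" by (simp add: bump_def)
  then show "bump w g \<noteq> zero" by auto
  show "lead (bump w g) = w"
    by (rule lead_eqI[OF e]) (simp add: is_lead_def w0, simp add: bump_def)
  show "lex g (bump w g)"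
    unfolding lex_def using w below_asym by (intro bexI[of _ w]) (auto simp: bump_def)
qed

text \<open>The place d that decides g < f carries a nonzero coefficient of f, so it is at or above
  the least exponent of f and therefore above w, where g is left unchanged.\<close>

lemma bump_less:
  assumes g: "g \<in> exponents" and f: "f \<in> exponents" and lex: "lex g f"
    and w: "below w (lead f)"
  shows "lex (bump w g) f"
proof -
  obtain d where d: "d \<in> Field \<alpha>" "g d < f d" "\<And>y. below d y \<Longrightarrow> g y = f y"
    using lex unfolding lex_def by auto
  have "d = lead f \<or> below (lead f) d" using is_lead_lead(2)[OF f, of d] d(2) by simp
  then have wd: "below w d" using w below_trans[of w "lead f" d] by auto
  have eq: "bump w g y = g y" if "below w y" for y
    using below_asym[OF that] that by (auto simp: bump_def)
  show ?thesis
    unfolding lex_def using d eq[OF wd] eq below_trans[OF wd] by (intro bexI[of _ d]) auto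
qed

text \<open>The point a + omega^w lies above a and has rank w; it stays below p because w is less
  than the rank of p.\<close>

lemma rank_between:
  assumes p: "p \<in> X.C" and a: "a \<in> X.C" "X.lt a p" and w: "w \<in> E.C" "E.lt w (point_rank p)"
  obtains q where "q \<in> X.C" "X.lt a q" "X.lt q p" "point_rank q = w"
proof -
  obtain j g where jg: "a = Some (j, g)" using a(2) lt_None by (cases a) auto
  then have g: "g \<in> exponents" "j < k" using a by (auto simp: Some_carrier)
  obtain x where x: "w = Some x" "x \<in> Field \<alpha>"
    using w by (cases w) (auto simp: ord_lt_def ord_carrier_def)
  note b = bump[OF g(1) x(2)]
  show ?thesis
  proof (rule that[of "Some (j, bump x g)"])
    show "Some (j, bump x g) \<in> X.C" using b g by (simp add: Some_carrier)
    show "X.lt a (Some (j, bump x g))" using b g jg by (simp add: lt_Some)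
    show "point_rank (Some (j, bump x g)) = w" using b x by simp
    show "X.lt (Some (j, bump x g)) p"
    proof (cases p)
      case None
      then show ?thesis using lt_None by simp
    next
      case (Some p')
      then obtain i f where pi: "p = Some (i, f)" by (cases p') auto
      then have f: "f \<in> exponents" "i < k" using p by (auto simp: Some_carrier)
      consider "j < i" | "j = i" "lex g f" using a(2) jg pi by (auto simp: lt_Some)
      then show ?thesis
      proof cases
        case 1
        then show ?thesis using pi f b g by (simp add: lt_Some)
      next
        case 2
        then have "f \<noteq> zero" by auto
        then have "below x (lead f)" using w(2) x pi by (simp add: ord_lt_def)
        then show ?thesis using bump_less[OF g(1) f(1) 2(2)] pi f b g 2 by (simp add: lt_Some)
      qed
    qed
  qed
qed

lemma least_point: "q \<in> X.C \<Longrightarrow> \<not> X.lt q (Some (0, zero))"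
  by (cases q) (auto simp: lt_Some lt_None)

lemma cb_rank: "cb_rank X.X \<alpha> point_rank"
  unfolding cb_rank_def X.topspace
proof (intro conjI ballI allI impI)
  show "point_rank p \<in> E.C" if "p \<in> X.C" for p using that by (rule rank_carrier)
  show "\<exists>U. openin X.X U \<and> p \<in> U \<and> (\<forall>q\<in>U - {p}. E.lt (point_rank q) (point_rank p))" if "p \<in> X.C" for p
    using that by (rule rank_nbhd)
next
  fix V p w assume V: "openin X.X V" "p \<in> V" and w: "w \<in> E.C" "E.lt w (point_rank p)"
  have p: "p \<in> X.C" using V openin_subset[OF V(1)] X.topspace by auto
  \<comment> \<open>Some rank lies below that of p, so p is not the ordinal 0; if V contains the
    whole segment up to p, then 0 can serve as the left end a.\<close>
  have "\<exists>a\<in>X.C. X.lt a p \<and> (\<forall>x\<in>X.C. X.lt a x \<and> X.le x p \<longrightarrow> x \<in> V)"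
  proof -
    have z: "Some (0, zero) \<in> X.C" using k by (simp add: Some_carrier)
    have "p \<noteq> Some (0, zero)"
    proof
      assume "p = Some (0, zero)"
      then have "E.lt w bottom" using w(2) by simp
      then show False using bottom(2)[OF w(1)] E.le_lt_trans E.lt_irrefl by blast
    qed
    then have "X.lt (Some (0, zero)) p" using X.lt_total[OF p z] least_point[OF p] by auto
    then show ?thesis using X.left_nbhd_openin[OF V] z unfolding X.left_nbhd_def by auto
  qed
  then obtain a where a: "a \<in> X.C" "X.lt a p" "\<And>x. x \<in> X.C \<Longrightarrow> X.lt a x \<Longrightarrow> X.le x p \<Longrightarrow> x \<in> V"
    by auto
  obtain q where q: "q \<in> X.C" "X.lt a q" "X.lt q p" "point_rank q = w"
    using rank_between[OF p a(1,2) w] by metis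
  then have "q \<in> V" using a(3) by (simp add: X.le_def)
  moreover have "q \<noteq> p" using q(3) by auto
  ultimately show "\<exists>q\<in>V - {p}. point_rank q = w" using q(4) by blast
qed

text \<open>The points of top rank are omega^\<alpha> * i with 1 \<le> i \<le> k. For \<alpha> = 0
  the rank 0 is itself the top one, so the ordinal 0 counts as well.\<close>

lemma card_top_rank:
  "card {p \<in> topspace X.X. point_rank p = None} = (if Field \<alpha> = {} then Suc k else k)"
proof -
  have "{p \<in> topspace X.X. point_rank p = None}
      = insert None ((\<lambda>i. Some (i, zero)) ` {i. i < k \<and> (i > 0 \<or> Field \<alpha> = {})})"
    (is "?A = insert None (?g ` ?I)")
  proof (intro set_eqI)
    fix p show "p \<in> ?A \<longleftrightarrow> p \<in> insert None (?g ` ?I)"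
    proof (cases p)
      case (Some q)
      then show ?thesis
        by (cases q) (auto simp: X.topspace Some_carrier bottom_None split: if_splits)
    qed (simp add: X.topspace)
  qed
  moreover have "card (?g ` ?I) = card ?I"
    by (rule card_image) (simp add: inj_on_def)
  moreover have "card ?I = (if Field \<alpha> = {} then k else k - 1)"
  proof (cases "Field \<alpha> = {}")
    case False
    then have "?I = {1..<k}" by auto
    then show ?thesis using False by simp
  qed simp
  moreover have "finite (?g ` ?I)" "None \<notin> ?g ` ?I" by auto
  ultimately show ?thesis using k by simp
qed

end

section \<open>From the group to the ordinal invariants\<close>

lemma topgrp_iso_homeomorphic:
  assumes "Well_order \<gamma>" "Well_order \<delta>" "topgrp_iso (ord_space \<gamma>) (ord_space \<delta>) \<phi>"
  shows "ord_space \<gamma> homeomorphic_space ord_space \<delta>"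
proof -
  have bij: "bij_betw \<phi> (homeo_group (ord_space \<gamma>)) (homeo_group (ord_space \<delta>))"
    and hom: "\<forall>g\<in>homeo_group (ord_space \<gamma>). \<forall>h\<in>homeo_group (ord_space \<gamma>).
      \<phi> (compose (topspace (ord_space \<gamma>)) g h) = compose (topspace (ord_space \<delta>)) (\<phi> g) (\<phi> h)"
    using assms(3) by (simp_all add: topgrp_iso_def)
  show ?thesis
    by (rule interleaved_spaces_homeomorphic[OF
          well_order_space.interleaved[OF well_order_space.intro[OF assms(1)]]
          well_order_space.interleaved[OF well_order_space.intro[OF assms(2)]] bij hom[rule_format]])
qed

text \<open>The rank function of the second space, pulled back along the homeomorphism, is a rank
  function on the first with values up to \<alpha>'. Comparing it with the one already there gives
  the exponent and shows that points of top rank correspond.\<close>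

lemma omega_power_homeomorphic:
  assumes "omega_power \<alpha> k" "omega_power \<alpha>' k'"
    and "ord_space (omega_pow_mult \<alpha> k) homeomorphic_space ord_space (omega_pow_mult \<alpha>' k')"
  shows "(\<alpha>, \<alpha>') \<in> ordIso" and "k = k'"
proof -
  interpret A: omega_power \<alpha> k by fact
  interpret B: omega_power \<alpha>' k' by fact
  obtain F F' where F: "homeomorphic_maps A.X.X B.X.X F F'"
    using assms(3) unfolding homeomorphic_space_def by auto
  have cF: "continuous_map A.X.X B.X.X F" "continuous_map B.X.X A.X.X F'"
    and inv: "\<And>x. x \<in> A.X.C \<Longrightarrow> F' (F x) = x" "\<And>y. y \<in> B.X.C \<Longrightarrow> F (F' y) = y"
    using F by (auto simp: homeomorphic_maps_def A.X.topspace B.X.topspace)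
  have mem: "\<And>x. x \<in> A.X.C \<Longrightarrow> F x \<in> B.X.C" "\<And>y. y \<in> B.X.C \<Longrightarrow> F' y \<in> A.X.C"
    using continuous_map_funspace[OF cF(1)] continuous_map_funspace[OF cF(2)]
    by (auto simp: A.X.topspace B.X.topspace Pi_iff)
  have r: "cb_rank A.X.X \<alpha>' (B.point_rank \<circ> F)"
    using cb_rank_homeomorphic[OF F B.cb_rank] .
  have top: "None \<in> topspace A.X.X" "A.point_rank None = None"
    "F' None \<in> topspace A.X.X" "(B.point_rank \<circ> F) (F' None) = None"
    using mem(2)[of None] inv(2)[of None] by (auto simp: A.X.topspace)
  note iso = cb_rank_ordIso[OF A.well_order_exp A.cb_rank B.well_order_exp r top]
  show ord: "(\<alpha>, \<alpha>') \<in> ordIso" by (rule iso(1))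
  have bb: "bij_betw F {p \<in> topspace A.X.X. A.point_rank p = None} {p \<in> topspace B.X.X. B.point_rank p = None}"
  proof (rule bij_betw_byWitness[where f' = F'])
    show "F ` {p \<in> topspace A.X.X. A.point_rank p = None} \<subseteq> {p \<in> topspace B.X.X. B.point_rank p = None}"
      using iso(2) mem(1) by (auto simp: A.X.topspace B.X.topspace)
    show "F' ` {p \<in> topspace B.X.X. B.point_rank p = None} \<subseteq> {p \<in> topspace A.X.X. A.point_rank p = None}"
    proof (rule image_subsetI)
      fix y assume y: "y \<in> {p \<in> topspace B.X.X. B.point_rank p = None}"
      then have "F' y \<in> topspace A.X.X" "(B.point_rank \<circ> F) (F' y) = None"
        using mem(2) inv(2) by (auto simp: A.X.topspace B.X.topspace)
      then show "F' y \<in> {p \<in> topspace A.X.X. A.point_rank p = None}" using iso(2) by simp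
    qed
  qed (use inv in \<open>auto simp: A.X.topspace B.X.topspace\<close>)
  have "(if Field \<alpha> = {} then Suc k else k) = (if Field \<alpha>' = {} then Suc k' else k')"
    using bij_betw_same_card[OF bb] by (simp only: A.card_top_rank B.card_top_rank)
  \<comment> \<open>The count exceeds the multiplicity by one exactly for exponent 0, so both sides
    must fall under the same case before k and k' can be compared.\<close>
  moreover have "Field \<alpha> = {} \<longleftrightarrow> Field \<alpha>' = {}"
  proof -
    obtain f where "iso \<alpha> \<alpha>' f" using ord by (auto simp: ordIso_def)
    then have "bij_betw f (Field \<alpha>) (Field \<alpha>')" by (simp add: iso_def)
    then show ?thesis by (auto simp: bij_betw_def)
  qed
  ultimately show "k = k'" by (cases "Field \<alpha> = {}") simp_all
qed

theorem theorem29: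
  fixes \<alpha> :: "'a rel" and \<alpha>' :: "'b rel" and k k' :: nat
    and \<gamma> :: "'c rel" and \<delta> :: "'d rel"
  shows "(Well_order \<alpha> \<and> Well_order \<alpha>' \<and> k \<ge> 1 \<and> k' \<ge> 1 \<and>
           (\<exists>\<phi>. topgrp_iso (ord_space (omega_pow_mult \<alpha> k)) (ord_space (omega_pow_mult \<alpha>' k')) \<phi>)
           \<longrightarrow> (\<alpha>, \<alpha>') \<in> ordIso \<and> k = k')
       \<and> (Well_order \<gamma> \<and> Well_order \<delta> \<and>
           (\<exists>\<phi>. topgrp_iso (ord_space \<gamma>) (ord_space \<delta>) \<phi>)
           \<longrightarrow> ord_space \<gamma> homeomorphic_space ord_space \<delta>)"
proof (intro conjI impI; elim conjE exE)
  fix \<phi> assume "Well_order \<alpha>" "Well_order \<alpha>'" "k \<ge> 1" "k' \<ge> 1"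
    and \<phi>: "topgrp_iso (ord_space (omega_pow_mult \<alpha> k)) (ord_space (omega_pow_mult \<alpha>' k')) \<phi>"
  then have o: "omega_power \<alpha> k" "omega_power \<alpha>' k'" by (simp_all add: omega_power_def)
  then have "ord_space (omega_pow_mult \<alpha> k) homeomorphic_space ord_space (omega_pow_mult \<alpha>' k')"
    by (intro topgrp_iso_homeomorphic[OF _ _ \<phi>] omega_power.well_order_R)
  then show "(\<alpha>, \<alpha>') \<in> ordIso" "k = k'"
    using omega_power_homeomorphic[OF o] by auto
qed (rule topgrp_iso_homeomorphic)

end
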